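(* (1) If $\vdash t:\exists\alpha\,A$ in $\mathsf{HA}+\mathsf{EM}_1^-$ (empty context), then there is a term $t'=(n,u)$ with $t\mapsto^*t'$ and $\vdash u:A[n/\alpha]$ in $\mathsf{HA}+\mathsf{EM}_1^-$. (2) If $\vdash t:A\lor B$ in $\mathsf{HA}+\mathsf{EM}_1^-$ (empty context), then there is a term $t'$ with $t\mapsto^*t'$ such that either $t'=\iota_0(u)$ and $\vdash u:A$, or $t'=\iota_1(u)$ and $\vdash u:B$, in $\mathsf{HA}+\mathsf{EM}_1^-$.
   Context: The language $\mathcal{L}$: terms are variables, $0$, and $\mathsf{S}(t)$ (numerals are $\mathsf{S}\cdots\mathsf{S}0$); there is a predicate symbol $\mathcal{P}$ for every primitive recursive relation on $\mathbb{N}$, with $\mathcal{P}^\bot$ the symbol of its complement; atomic formulas are $\mathcal{P}(t_1,\dots,t_n)$, and $\mathcal{P}(\vec t)^\bot:=\mathcal{P}^\bot(\vec t)$. Formulas are built with $\land,\lor,\rightarrow,\forall,\exists$ over natural numbers. A propositional formula is quantifier-free; negative if $\lor$ does not occur. Proof terms of $\mathsf{HA}+\mathsf{EM}_1^-$: $x\mid tu\mid tm\mid\lambda x.u\mid\lambda\alpha.u\mid\langle t,u\rangle\mid\pi_0u\mid\pi_1u\mid\iota_0(u)\mid\iota_1(u)\mid t[x.u,y.v]\mid(m,t)\mid t[(\alpha,x).u]\mid(u\parallel_a v)\mid\mathsf{H}_a^{\alpha P}\mid\mathsf{W}_a^{\alpha P}\mid\mathsf{True}\mid\mathsf{R}uvm\mid\mathsf{r}t_1\dots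 t_n$. Typing: the usual intuitionistic Curry–Howard rules ($\Gamma,x:A\vdash x:A$; pairing/projections for $\land$; $\lambda$/application for $\rightarrow$; $\iota_i$ and $u[x.w_1,y.w_2]$ for $\lor$; $\lambda\alpha.u$ ($\alpha$ not free in $\Gamma$) and $um:A[m/\alpha]$ for $\forall$; $(m,u):\exists\alpha A$ from $u:A[m/\alpha]$ and $u[(\alpha,x).t]:C$ from $u:\exists\alpha A$, $\Gamma,x:A\vdash t:C$ ($\alpha$ not free in $C,\Gamma$) for $\exists$); axioms $\Gamma,a:\forall\alpha P\vdash\mathsf{H}_a^{\alpha P}:\forall\alpha P$ and $\Gamma,a:\exists\alpha P^\bot\vdash\mathsf{W}_a^{\alpha P}:\exists\alpha P^\bot$; induction: from $u:A(0)$ and $v:\forall\alpha(A(\alpha)\rightarrow A(\mathsf{S}\alpha))$ infer $\mathsf{R}uvm:A[m/\alpha]$; Post rules: from $u_i:A_i$ ($i=1..n$) infer $\mathsf{r}u_1\dots u_n:A$ (or $\mathsf{True}:A$ if $n=0$) whenever $A_1,\dots,A_n,A$ atomic and the inference is a Post rule for equality, Peano axioms, classical propositional tautologies or booleans; $\mathsf{EM}_1^-$: from $\Gamma,a:\forall\alpha P\vdash u:\exists\beta Q$ and $\Gamma,a:\exists\alpha P^\bot\vdash v:\exists\beta Q$ ($P$ atomic, $Q$ negative propositional) infer $\Gamma\vdash(u\parallel_a v):\exists\beta Q$, where $a$ occurs free in $u$ only within $\mathsf{H}_a^{\alpha P}$ and in $v$ only within $\mathsf{W}_a^{\alpha P}$.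 Reduction rules (on any subterm): $(\lambda x.u)t\mapsto u[t/x]$; $(\lambda\alpha.u)m\mapsto u[m/\alpha]$; $\pi_i\langle u_0,u_1\rangle\mapsto u_i$; $\iota_i(u)[x_0.t_0,x_1.t_1]\mapsto t_i[u/x_i]$; $(m,u)[(\alpha,x).v]\mapsto v[m/\alpha][u/x]$; $\mathsf{R}uv0\mapsto u$; $\mathsf{R}uv(\mathsf{S}n)\mapsto vn(\mathsf{R}uvn)$ for numerals $n$; $u\parallel_a v\mapsto u$ if $a$ is not free in $u$; $u\parallel_a v\mapsto v[a:=n]$ if $\mathsf{H}_a^{\alpha P}n$ occurs in $u$, $P[n/\alpha]$ is closed and false, where $v[a:=n]$ replaces each free $\mathsf{W}_a^{\alpha P}$ in $v$ by $(n,\mathsf{True})$; $\mathsf{H}_a^{\alpha P}n\mapsto\mathsf{True}$ if $P[n/\alpha]$ is closed and true. $\mapsto^*$ is the reflexive-transitive closure of $\mapsto$.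
   Formalization: The proof term t is assumed to have no free number variables; otherwise the claim fails: with b a free number variable, R (0,True) (λγ.λx.(0,True)) b has type ∃α α=α in the empty context, is normal, and is not a pair. *)

theory Defs
  imports Main
begin

section \<open>Primitive recursive relations\<close>

text \<open>An \<open>n\<close>-ary function is a function on lists of which only the values on lists of length \<open>n\<close>
  matter; this is what the last rule expresses.\<close>

inductive prim_rec :: "nat \<Rightarrow> (nat list \<Rightarrow> nat) \<Rightarrow> bool" where
  zero: "prim_rec n (\<lambda>_. 0)"
| succ: "prim_rec 1 (\<lambda>xs. Suc (xs ! 0))"
| proj: "i < n \<Longrightarrow> prim_rec n (\<lambda>xs. xs ! i)"
| comp: "prim_rec (length gs) f \<Longrightarrow> \<forall>g\<in>set gs. prim_rec n g \<Longrightarrow>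
    prim_rec n (\<lambda>xs. f (map (\<lambda>g. g xs) gs))"
| prec: "prim_rec n f \<Longrightarrow> prim_rec (Suc (Suc n)) g \<Longrightarrow>
    prim_rec (Suc n) (\<lambda>xs. rec_nat (f (tl xs)) (\<lambda>y r. g (y # r # tl xs)) (hd xs))"
| ext: "prim_rec n f \<Longrightarrow> \<forall>xs. length xs = n \<longrightarrow> f xs = g xs \<Longrightarrow> prim_rec n g"

definition prim_rec_rel :: "nat \<Rightarrow> nat list set \<Rightarrow> bool" where
  "prim_rec_rel n X \<longleftrightarrow> (\<forall>xs\<in>X. length xs = n) \<and> prim_rec n (\<lambda>xs. if xs \<in> X then 1 else 0)"

lemma prim_rec_comp1: "prim_rec 1 f \<Longrightarrow> prim_rec n g \<Longrightarrow> prim_rec n (\<lambda>xs. f [g xs])"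
  using prim_rec.comp[of "[g]" f n] by simp

lemma prim_rec_comp2:
  "prim_rec 2 f \<Longrightarrow> prim_rec n g \<Longrightarrow> prim_rec n h \<Longrightarrow> prim_rec n (\<lambda>xs. f [g xs, h xs])"
  using prim_rec.comp[of "[g, h]" f n] by (simp add: numeral_2_eq_2)

lemma prim_rec_pred: "prim_rec 1 (\<lambda>xs. xs ! 0 - 1)"
proof (rule prim_rec.ext)
  show "prim_rec 1 (\<lambda>xs. rec_nat 0 (\<lambda>y r. (y # r # tl xs) ! 0) (hd xs))"
    using prim_rec.prec[OF prim_rec.zero[of 0] prim_rec.proj[of 0 "Suc (Suc 0)"]] by simp
  show "\<forall>xs. length xs = 1 \<longrightarrow> rec_nat 0 (\<lambda>y r. (y # r # tl xs) ! 0) (hd xs) = xs ! 0 - 1"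
  proof (intro allI impI)
    fix xs :: "nat list" assume "length xs = 1"
    then obtain x where "xs = [x]" by (cases xs) auto
    then show "rec_nat 0 (\<lambda>y r. (y # r # tl xs) ! 0) (hd xs) = xs ! 0 - 1" by (cases x) auto
  qed
qed

lemma prim_rec_minus:
  assumes "prim_rec n f" "prim_rec n g"
  shows "prim_rec n (\<lambda>xs. f xs - g xs)"
proof -
  let ?s = "\<lambda>xs. rec_nat (tl xs ! 0) (\<lambda>y r. (y # r # tl xs) ! 1 - 1) (hd xs)"
  have "prim_rec 3 (\<lambda>xs. xs ! 1 - 1)"
    using prim_rec_comp1[OF prim_rec_pred prim_rec.proj[of 1 3]] by simp
  then have s: "prim_rec 2 ?s"
    using prim_rec.prec[OF prim_rec.proj[of 0 1], of "\<lambda>xs. xs ! 1 - 1"]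
    by (simp add: numeral_2_eq_2 numeral_3_eq_3)
  have "rec_nat a (\<lambda>y r. r - Suc 0) b = a - b" for a b :: nat by (induction b) auto
  then show ?thesis using prim_rec_comp2[OF s assms(2,1)] by simp
qed

lemma prim_rec_one: "prim_rec n (\<lambda>_. 1)"
  using prim_rec_comp1[OF prim_rec.succ prim_rec.zero[of n]] by simp

lemma prim_rec_rel_compl: "prim_rec_rel n X \<Longrightarrow> prim_rec_rel n ({xs. length xs = n} - X)"
proof -
  assume X: "prim_rec_rel n X"
  then have "prim_rec n (\<lambda>xs. 1 - (if xs \<in> X then 1 else 0))"
    unfolding prim_rec_rel_def by (intro prim_rec_minus prim_rec_one) simp
  then have "prim_rec n (\<lambda>xs. if xs \<in> {xs. length xs = n} - X then 1 else 0)"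
    by (rule prim_rec.ext) simp
  then show ?thesis by (simp add: prim_rec_rel_def)
qed

lemma prim_rec_rel_eq: "prim_rec_rel 2 {xs. \<exists>x. xs = [x, x]}"
proof -
  have p: "prim_rec 2 (\<lambda>xs. xs ! 0)" "prim_rec 2 (\<lambda>xs. xs ! 1)" by (auto intro: prim_rec.proj)
  let ?f = "\<lambda>xs. (1 - (xs ! 1 - xs ! 0)) - (xs ! 0 - xs ! (1 :: nat) :: nat)"
  have "prim_rec 2 ?f" by (intro prim_rec_minus prim_rec_one p)
  moreover have "?f xs = (if xs \<in> {xs. \<exists>x. xs = [x, x]} then 1 else 0)"
    if len: "length xs = 2" for xs :: "nat list"
  proof -
    obtain x y where "xs = [x, y]" using len
      by (auto simp: numeral_2_eq_2 length_Suc_conv)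
    then show ?thesis by auto
  qed
  ultimately have "prim_rec 2 (\<lambda>xs. if xs \<in> {xs. \<exists>x. xs = [x, x]} then 1 else 0)"
    by (blast intro: prim_rec.ext[of 2 ?f])
  then show ?thesis by (auto simp: prim_rec_rel_def)
qed


section \<open>The language\<close>

text \<open>A predicate symbol is a primitive recursive relation, together with its arity.\<close>

typedef psym = "{(n, X). prim_rec_rel n X}"
  using prim_rec_rel_eq by auto

definition arity :: "psym \<Rightarrow> nat" where
  "arity P = fst (Rep_psym P)"

definition rel :: "psym \<Rightarrow> nat list set" where
  "rel P = snd (Rep_psym P)"

definition psym_compl :: "psym \<Rightarrow> psym" where
  "psym_compl P = Abs_psym (arity P, {xs. length xs = arity P} - rel P)"

definition eq_sym :: psym where
  "eq_sym = Abs_psym (2, {xs. \<exists>x. xs = [x, x]})"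

lemma prim_rec_rel_psym: "prim_rec_rel (arity P) (rel P)"
  using Rep_psym[of P] by (auto simp: arity_def rel_def)

lemma arity_psym_compl [simp]: "arity (psym_compl P) = arity P"
  and rel_psym_compl: "rel (psym_compl P) = {xs. length xs = arity P} - rel P"
  using Abs_psym_inverse[of "(arity P, {xs. length xs = arity P} - rel P)"]
    prim_rec_rel_compl[OF prim_rec_rel_psym[of P]]
  by (auto simp: psym_compl_def arity_def[of "Abs_psym _"] rel_def[of "Abs_psym _"])

lemma arity_eq_sym [simp]: "arity eq_sym = 2"
  and rel_eq_sym: "rel eq_sym = {xs. \<exists>x. xs = [x, x]}"
  using Abs_psym_inverse[of "(2, {xs. \<exists>x. xs = [x, x]})"] prim_rec_rel_eq
  by (auto simp: eq_sym_def arity_def rel_def)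

text \<open>All binding is by de Bruijn indices. There are three independent sorts of variables: number
  variables (\<open>\<alpha>\<close>), proof variables (\<open>x\<close>) and hypothesis variables (\<open>a\<close>).\<close>

datatype tm = TVar nat | Zero | Succ tm

primrec num :: "nat \<Rightarrow> tm" where
  "num 0 = Zero"
| "num (Suc n) = Succ (num n)"

typedef atom = "{(P :: psym, ts :: tm list). length ts = arity P}"
proof -
  have "(eq_sym, [Zero, Zero]) \<in> {(P, ts). length ts = arity P}" by simp
  then show ?thesis by blast
qed

setup_lifting type_definition_atom

lift_definition sym :: "atom \<Rightarrow> psym" is fst .

lift_definition args :: "atom \<Rightarrow> tm list" is snd .

lift_definition atom_compl :: "atom \<Rightarrow> atom" is "\<lambda>(P, ts). (psym_compl P, ts)"
  by auto

lift_definition Eq :: "tm \<Rightarrow> tm \<Rightarrow> atom" is "\<lambda>t u. (eq_sym, [t, u])"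
  by simp

datatype fm = Atm atom | And fm fm | Or fm fm | Imp fm fm | All fm | Ex fm

primrec neg_prop :: "fm \<Rightarrow> bool" where
  "neg_prop (Atm P) \<longleftrightarrow> True"
| "neg_prop (And A B) \<longleftrightarrow> neg_prop A \<and> neg_prop B"
| "neg_prop (Or A B) \<longleftrightarrow> False"
| "neg_prop (Imp A B) \<longleftrightarrow> neg_prop A \<and> neg_prop B"
| "neg_prop (All A) \<longleftrightarrow> False"
| "neg_prop (Ex A) \<longleftrightarrow> False"


subsection \<open>Substitution for number variables\<close>

primrec tsub :: "(nat \<Rightarrow> tm) \<Rightarrow> tm \<Rightarrow> tm" where
  "tsub \<sigma> (TVar i) = \<sigma> i"
| "tsub \<sigma> Zero = Zero"
| "tsub \<sigma> (Succ t) = Succ (tsub \<sigma> t)"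

definition shift :: "nat \<Rightarrow> tm" where
  "shift i = TVar (Suc i)"

definition up :: "(nat \<Rightarrow> tm) \<Rightarrow> nat \<Rightarrow> tm" where
  "up \<sigma> = case_nat (TVar 0) (\<lambda>i. tsub shift (\<sigma> i))"

definition inst :: "tm \<Rightarrow> nat \<Rightarrow> tm" where
  "inst m = case_nat m TVar"

text \<open>\<open>A(\<alpha>)\<close> becomes \<open>A(S \<alpha>)\<close>, where \<open>\<alpha>\<close> is the variable \<open>0\<close>.\<close>

definition step :: "nat \<Rightarrow> tm" where
  "step = case_nat (Succ (TVar 0)) shift"

lift_definition asub :: "(nat \<Rightarrow> tm) \<Rightarrow> atom \<Rightarrow> atom" is "\<lambda>\<sigma> (P, ts). (P, map (tsub \<sigma>) ts)"
  by auto

primrec fsub :: "(nat \<Rightarrow> tm) \<Rightarrow> fm \<Rightarrow> fm" where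
  "fsub \<sigma> (Atm P) = Atm (asub \<sigma> P)"
| "fsub \<sigma> (And A B) = And (fsub \<sigma> A) (fsub \<sigma> B)"
| "fsub \<sigma> (Or A B) = Or (fsub \<sigma> A) (fsub \<sigma> B)"
| "fsub \<sigma> (Imp A B) = Imp (fsub \<sigma> A) (fsub \<sigma> B)"
| "fsub \<sigma> (All A) = All (fsub (up \<sigma>) A)"
| "fsub \<sigma> (Ex A) = Ex (fsub (up \<sigma>) A)"


subsection \<open>Truth of atomic formulas\<close>

primrec tval :: "(nat \<Rightarrow> nat) \<Rightarrow> tm \<Rightarrow> nat" where
  "tval e (TVar i) = e i"
| "tval e Zero = 0"
| "tval e (Succ t) = Suc (tval e t)"

definition holds :: "(nat \<Rightarrow> nat) \<Rightarrow> atom \<Rightarrow> bool" where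
  "holds e P \<longleftrightarrow> map (tval e) (args P) \<in> rel (sym P)"

primrec tfv :: "tm \<Rightarrow> nat set" where
  "tfv (TVar i) = {i}"
| "tfv Zero = {}"
| "tfv (Succ t) = tfv t"

definition afv :: "atom \<Rightarrow> nat set" where
  "afv P = (\<Union>t\<in>set (args P). tfv t)"

definition closed_true :: "atom \<Rightarrow> bool" where
  "closed_true P \<longleftrightarrow> afv P = {} \<and> (\<forall>e. holds e P)"

definition closed_false :: "atom \<Rightarrow> bool" where
  "closed_false P \<longleftrightarrow> afv P = {} \<and> (\<forall>e. \<not> holds e P)"


section \<open>Post rules\<close>

text \<open>A set \<open>R\<close> of Post rules for arithmetic: \<open>R As A\<close> says that \<open>A\<close> may be inferred from the list \<open>As\<close>.
  The set is not fixed completely. It consists of schematic, arithmetically valid inferences between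
  atomic formulas, and it contains the rules for equality, the Peano axioms for \<open>0\<close> and \<open>S\<close>,
  propositional tautologies, and the evaluation of closed atoms to booleans. Further valid rules,
  such as defining rules of primitive recursive relations, may or may not be present.

  Predicate symbols are closed under Boolean operations and \<open>P\<close> is the same symbol as
  \<open>(P\<^sub>1 \<and> \<dots> \<and> P\<^sub>n) \<or> P\<close> whenever the intersection of the \<open>P\<^sub>i\<close> is included in \<open>P\<close>. So the tautological
  inferences between Boolean combinations of predicates applied to the same arguments are
  precisely the inclusions in \<open>taut\<close>.\<close>

locale arith_post_rules =
  fixes R :: "atom list \<Rightarrow> atom \<Rightarrow> bool"
  assumes schematic: "R As A \<Longrightarrow> R (map (asub \<sigma>) As) (asub \<sigma> A)"
    and valid: "R As A \<Longrightarrow> \<forall>B\<in>set As. holds e B \<Longrightarrow> holds e A"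
    and eq_refl: "R [] (Eq t t)"
    and eq_subst: "R [Eq t u, asub (inst t) A] (asub (inst u) A)"
    and succ_inj: "R [Eq (Succ t) (Succ u)] (Eq t u)"
    and succ_not_zero: "R [] (atom_compl (Eq (Succ t) Zero))"
    and taut: "\<forall>B\<in>set As. args B = args A \<Longrightarrow>
      \<forall>xs. length xs = length (args A) \<longrightarrow> (\<forall>B\<in>set As. xs \<in> rel (sym B)) \<longrightarrow> xs \<in> rel (sym A) \<Longrightarrow>
      R As A"
    and contradiction: "R [A, atom_compl A] B"
    and bool: "closed_true A \<Longrightarrow> R [] A"

lemma holds_asub: "holds e (asub \<sigma> A) \<longleftrightarrow> holds (\<lambda>i. tval e (\<sigma> i)) A"
proof -
  have "tval e (tsub \<sigma> t) = tval (\<lambda>i. tval e (\<sigma> i)) t" for t by (induction t) auto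
  then show ?thesis
    by (simp add: holds_def args.rep_eq sym.rep_eq asub.rep_eq o_def split: prod.splits)
qed

lemma holds_Eq: "holds e (Eq t u) \<longleftrightarrow> tval e t = tval e u"
  by (auto simp: holds_def args.rep_eq sym.rep_eq Eq.rep_eq rel_eq_sym)

lemma length_args: "length (args A) = arity (sym A)"
  by transfer auto

lemma args_atom_compl: "args (atom_compl A) = args A"
  by transfer auto

lemma sym_atom_compl: "sym (atom_compl A) = psym_compl (sym A)"
  by transfer auto

lemma holds_atom_compl: "holds e (atom_compl A) \<longleftrightarrow> \<not> holds e A"
  by (simp add: holds_def args_atom_compl sym_atom_compl rel_psym_compl length_args)

text \<open>All valid inferences between atomic formulas together form such a set, so the locale is consistent.\<close>

lemma arith_post_rules_valid:
  "arith_post_rules (\<lambda>As A. \<forall>e. (\<forall>B\<in>set As. holds e B) \<longrightarrow> holds e A)"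
proof -
  have eq: "holds e (asub (inst u) A)" if "tval e t = tval e u" "holds e (asub (inst t) A)" for e t u A
  proof -
    have "(\<lambda>i. tval e (inst t i)) = (\<lambda>i. tval e (inst u i))"
      using that(1) by (auto simp: inst_def fun_eq_iff split: nat.splits)
    then show ?thesis using that(2) by (simp add: holds_asub)
  qed
  show ?thesis
  proof (unfold_locales, goal_cases)
    case 1 then show ?case by (simp add: holds_asub)
  next
    case 2 then show ?case by blast
  next
    case 4 then show ?case by (auto simp: holds_Eq intro: eq)
  next
    case 7 then show ?case by (simp add: holds_def)
  next
    case 9 then show ?case by (simp add: closed_true_def)
  qed (simp_all add: holds_Eq holds_atom_compl)
qed


section \<open>Proof terms\<close>

text \<open>Binding structure: \<open>Lam u\<close> and the branches of \<open>Case t u v\<close> bind a proof variable, \<open>TLam u\<close>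
  binds a number variable, \<open>Unpack t u\<close> (written \<open>t[(\<alpha>, x). u]\<close> on paper) binds a number and a proof
  variable in \<open>u\<close>, and \<open>Par u v\<close> (written \<open>u \<parallel>\<^sub>a v\<close>) binds a hypothesis variable in \<open>u\<close> and in \<open>v\<close>.
  In the annotations of \<open>Hyp a P\<close> and \<open>Wit a P\<close> (\<open>H\<close> and \<open>W\<close> on paper) the number variable \<open>0\<close> of \<open>P\<close> is bound.\<close>

datatype pterm =
    Var nat
  | App pterm pterm
  | TApp pterm tm
  | Lam pterm
  | TLam pterm
  | PPair pterm pterm
  | Proj0 pterm
  | Proj1 pterm
  | Inj0 pterm
  | Inj1 pterm
  | Case pterm pterm pterm
  | Pack tm pterm
  | Unpack pterm pterm
  | Par pterm pterm
  | Hyp nat atom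
  | Wit nat atom
  | TrueP
  | Rec pterm pterm tm
  | Post "pterm list"

primrec nfv :: "pterm \<Rightarrow> nat set" where
  "nfv (Var x) = {}"
| "nfv (App t u) = nfv t \<union> nfv u"
| "nfv (TApp t m) = nfv t \<union> tfv m"
| "nfv (Lam u) = nfv u"
| "nfv (TLam u) = {i. Suc i \<in> nfv u}"
| "nfv (PPair t u) = nfv t \<union> nfv u"
| "nfv (Proj0 u) = nfv u"
| "nfv (Proj1 u) = nfv u"
| "nfv (Inj0 u) = nfv u"
| "nfv (Inj1 u) = nfv u"
| "nfv (Case t u v) = nfv t \<union> nfv u \<union> nfv v"
| "nfv (Pack m u) = tfv m \<union> nfv u"
| "nfv (Unpack t u) = nfv t \<union> {i. Suc i \<in> nfv u}"
| "nfv (Par u v) = nfv u \<union> nfv v"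
| "nfv (Hyp a P) = {i. Suc i \<in> afv P}"
| "nfv (Wit a P) = {i. Suc i \<in> afv P}"
| "nfv TrueP = {}"
| "nfv (Rec u v m) = nfv u \<union> nfv v \<union> tfv m"
| "nfv (Post us) = \<Union>(set (map nfv us))"

text \<open>Substitution of number terms for number variables.\<close>

primrec nsub :: "(nat \<Rightarrow> tm) \<Rightarrow> pterm \<Rightarrow> pterm" where
  "nsub \<sigma> (Var x) = Var x"
| "nsub \<sigma> (App t u) = App (nsub \<sigma> t) (nsub \<sigma> u)"
| "nsub \<sigma> (TApp t m) = TApp (nsub \<sigma> t) (tsub \<sigma> m)"
| "nsub \<sigma> (Lam u) = Lam (nsub \<sigma> u)"
| "nsub \<sigma> (TLam u) = TLam (nsub (up \<sigma>) u)"
| "nsub \<sigma> (PPair t u) = PPair (nsub \<sigma> t) (nsub \<sigma> u)"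
| "nsub \<sigma> (Proj0 u) = Proj0 (nsub \<sigma> u)"
| "nsub \<sigma> (Proj1 u) = Proj1 (nsub \<sigma> u)"
| "nsub \<sigma> (Inj0 u) = Inj0 (nsub \<sigma> u)"
| "nsub \<sigma> (Inj1 u) = Inj1 (nsub \<sigma> u)"
| "nsub \<sigma> (Case t u v) = Case (nsub \<sigma> t) (nsub \<sigma> u) (nsub \<sigma> v)"
| "nsub \<sigma> (Pack m u) = Pack (tsub \<sigma> m) (nsub \<sigma> u)"
| "nsub \<sigma> (Unpack t u) = Unpack (nsub \<sigma> t) (nsub (up \<sigma>) u)"
| "nsub \<sigma> (Par u v) = Par (nsub \<sigma> u) (nsub \<sigma> v)"
| "nsub \<sigma> (Hyp a P) = Hyp a (asub (up \<sigma>) P)"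
| "nsub \<sigma> (Wit a P) = Wit a (asub (up \<sigma>) P)"
| "nsub \<sigma> TrueP = TrueP"
| "nsub \<sigma> (Rec u v m) = Rec (nsub \<sigma> u) (nsub \<sigma> v) (tsub \<sigma> m)"
| "nsub \<sigma> (Post us) = Post (map (nsub \<sigma>) us)"

text \<open>Renaming of hypothesis variables and of proof variables.\<close>

definition up_ren :: "(nat \<Rightarrow> nat) \<Rightarrow> nat \<Rightarrow> nat" where
  "up_ren \<rho> = case_nat 0 (\<lambda>i. Suc (\<rho> i))"

primrec hren :: "(nat \<Rightarrow> nat) \<Rightarrow> pterm \<Rightarrow> pterm" where
  "hren \<rho> (Var x) = Var x"
| "hren \<rho> (App t u) = App (hren \<rho> t) (hren \<rho> u)"
| "hren \<rho> (TApp t m) = TApp (hren \<rho> t) m"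
| "hren \<rho> (Lam u) = Lam (hren \<rho> u)"
| "hren \<rho> (TLam u) = TLam (hren \<rho> u)"
| "hren \<rho> (PPair t u) = PPair (hren \<rho> t) (hren \<rho> u)"
| "hren \<rho> (Proj0 u) = Proj0 (hren \<rho> u)"
| "hren \<rho> (Proj1 u) = Proj1 (hren \<rho> u)"
| "hren \<rho> (Inj0 u) = Inj0 (hren \<rho> u)"
| "hren \<rho> (Inj1 u) = Inj1 (hren \<rho> u)"
| "hren \<rho> (Case t u v) = Case (hren \<rho> t) (hren \<rho> u) (hren \<rho> v)"
| "hren \<rho> (Pack m u) = Pack m (hren \<rho> u)"
| "hren \<rho> (Unpack t u) = Unpack (hren \<rho> t) (hren \<rho> u)"
| "hren \<rho> (Par u v) = Par (hren (up_ren \<rho>) u) (hren (up_ren \<rho>) v)"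
| "hren \<rho> (Hyp a P) = Hyp (\<rho> a) P"
| "hren \<rho> (Wit a P) = Wit (\<rho> a) P"
| "hren \<rho> TrueP = TrueP"
| "hren \<rho> (Rec u v m) = Rec (hren \<rho> u) (hren \<rho> v) m"
| "hren \<rho> (Post us) = Post (map (hren \<rho>) us)"

primrec pren :: "(nat \<Rightarrow> nat) \<Rightarrow> pterm \<Rightarrow> pterm" where
  "pren \<rho> (Var x) = Var (\<rho> x)"
| "pren \<rho> (App t u) = App (pren \<rho> t) (pren \<rho> u)"
| "pren \<rho> (TApp t m) = TApp (pren \<rho> t) m"
| "pren \<rho> (Lam u) = Lam (pren (up_ren \<rho>) u)"
| "pren \<rho> (TLam u) = TLam (pren \<rho> u)"
| "pren \<rho> (PPair t u) = PPair (pren \<rho> t) (pren \<rho> u)"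
| "pren \<rho> (Proj0 u) = Proj0 (pren \<rho> u)"
| "pren \<rho> (Proj1 u) = Proj1 (pren \<rho> u)"
| "pren \<rho> (Inj0 u) = Inj0 (pren \<rho> u)"
| "pren \<rho> (Inj1 u) = Inj1 (pren \<rho> u)"
| "pren \<rho> (Case t u v) = Case (pren \<rho> t) (pren (up_ren \<rho>) u) (pren (up_ren \<rho>) v)"
| "pren \<rho> (Pack m u) = Pack m (pren \<rho> u)"
| "pren \<rho> (Unpack t u) = Unpack (pren \<rho> t) (pren (up_ren \<rho>) u)"
| "pren \<rho> (Par u v) = Par (pren \<rho> u) (pren \<rho> v)"
| "pren \<rho> (Hyp a P) = Hyp a P"
| "pren \<rho> (Wit a P) = Wit a P"
| "pren \<rho> TrueP = TrueP"
| "pren \<rho> (Rec u v m) = Rec (pren \<rho> u) (pren \<rho> v) m"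
| "pren \<rho> (Post us) = Post (map (pren \<rho>) us)"

text \<open>Substitution of proof terms for proof variables. The substituted terms are shifted in the sort
  of each binder that is passed.\<close>

definition up_p :: "(nat \<Rightarrow> pterm) \<Rightarrow> nat \<Rightarrow> pterm" where
  "up_p \<theta> = case_nat (Var 0) (\<lambda>i. pren Suc (\<theta> i))"

definition up_n :: "(nat \<Rightarrow> pterm) \<Rightarrow> nat \<Rightarrow> pterm" where
  "up_n \<theta> = (\<lambda>i. nsub shift (\<theta> i))"

definition up_h :: "(nat \<Rightarrow> pterm) \<Rightarrow> nat \<Rightarrow> pterm" where
  "up_h \<theta> = (\<lambda>i. hren Suc (\<theta> i))"

definition inst_p :: "pterm \<Rightarrow> nat \<Rightarrow> pterm" where
  "inst_p u = case_nat u Var"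

primrec psub :: "(nat \<Rightarrow> pterm) \<Rightarrow> pterm \<Rightarrow> pterm" where
  "psub \<theta> (Var x) = \<theta> x"
| "psub \<theta> (App t u) = App (psub \<theta> t) (psub \<theta> u)"
| "psub \<theta> (TApp t m) = TApp (psub \<theta> t) m"
| "psub \<theta> (Lam u) = Lam (psub (up_p \<theta>) u)"
| "psub \<theta> (TLam u) = TLam (psub (up_n \<theta>) u)"
| "psub \<theta> (PPair t u) = PPair (psub \<theta> t) (psub \<theta> u)"
| "psub \<theta> (Proj0 u) = Proj0 (psub \<theta> u)"
| "psub \<theta> (Proj1 u) = Proj1 (psub \<theta> u)"
| "psub \<theta> (Inj0 u) = Inj0 (psub \<theta> u)"
| "psub \<theta> (Inj1 u) = Inj1 (psub \<theta> u)"
| "psub \<theta> (Case t u v) = Case (psub \<theta> t) (psub (up_p \<theta>) u) (psub (up_p \<theta>) v)"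
| "psub \<theta> (Pack m u) = Pack m (psub \<theta> u)"
| "psub \<theta> (Unpack t u) = Unpack (psub \<theta> t) (psub (up_p (up_n \<theta>)) u)"
| "psub \<theta> (Par u v) = Par (psub (up_h \<theta>) u) (psub (up_h \<theta>) v)"
| "psub \<theta> (Hyp a P) = Hyp a P"
| "psub \<theta> (Wit a P) = Wit a P"
| "psub \<theta> TrueP = TrueP"
| "psub \<theta> (Rec u v m) = Rec (psub \<theta> u) (psub \<theta> v) m"
| "psub \<theta> (Post us) = Post (map (psub \<theta>) us)"

primrec hfree :: "nat \<Rightarrow> pterm \<Rightarrow> bool" where
  "hfree k (Var x) \<longleftrightarrow> False"
| "hfree k (App t u) \<longleftrightarrow> hfree k t \<or> hfree k u"
| "hfree k (TApp t m) \<longleftrightarrow> hfree k t"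
| "hfree k (Lam u) \<longleftrightarrow> hfree k u"
| "hfree k (TLam u) \<longleftrightarrow> hfree k u"
| "hfree k (PPair t u) \<longleftrightarrow> hfree k t \<or> hfree k u"
| "hfree k (Proj0 u) \<longleftrightarrow> hfree k u"
| "hfree k (Proj1 u) \<longleftrightarrow> hfree k u"
| "hfree k (Inj0 u) \<longleftrightarrow> hfree k u"
| "hfree k (Inj1 u) \<longleftrightarrow> hfree k u"
| "hfree k (Case t u v) \<longleftrightarrow> hfree k t \<or> hfree k u \<or> hfree k v"
| "hfree k (Pack m u) \<longleftrightarrow> hfree k u"
| "hfree k (Unpack t u) \<longleftrightarrow> hfree k t \<or> hfree k u"
| "hfree k (Par u v) \<longleftrightarrow> hfree (Suc k) u \<or> hfree (Suc k) v"
| "hfree k (Hyp a P) \<longleftrightarrow> a = k"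
| "hfree k (Wit a P) \<longleftrightarrow> a = k"
| "hfree k TrueP \<longleftrightarrow> False"
| "hfree k (Rec u v m) \<longleftrightarrow> hfree k u \<or> hfree k v"
| "hfree k (Post us) \<longleftrightarrow> (\<exists>b\<in>set (map (hfree k) us). b)"

text \<open>\<open>raises k n u\<close>: for some \<open>P\<close> with \<open>P[n/\<alpha>]\<close> closed and false, \<open>Hyp a P\<close> applied to the numeral \<open>n\<close>
  occurs in \<open>u\<close>, where \<open>a\<close> is the free hypothesis variable \<open>k\<close>. Such a \<open>P\<close> has no free number variable
  besides \<open>0\<close>, so it is not affected by the number binders above the occurrence.\<close>

primrec raises :: "nat \<Rightarrow> nat \<Rightarrow> pterm \<Rightarrow> bool" where
  "raises k n (Var x) \<longleftrightarrow> False"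
| "raises k n (App t u) \<longleftrightarrow> raises k n t \<or> raises k n u"
| "raises k n (TApp t m) \<longleftrightarrow>
    (\<exists>P. t = Hyp k P \<and> m = num n \<and> closed_false (asub (inst (num n)) P)) \<or> raises k n t"
| "raises k n (Lam u) \<longleftrightarrow> raises k n u"
| "raises k n (TLam u) \<longleftrightarrow> raises k n u"
| "raises k n (PPair t u) \<longleftrightarrow> raises k n t \<or> raises k n u"
| "raises k n (Proj0 u) \<longleftrightarrow> raises k n u"
| "raises k n (Proj1 u) \<longleftrightarrow> raises k n u"
| "raises k n (Inj0 u) \<longleftrightarrow> raises k n u"
| "raises k n (Inj1 u) \<longleftrightarrow> raises k n u"
| "raises k n (Case t u v) \<longleftrightarrow> raises k n t \<or> raises k n u \<or> raises k n v"
| "raises k n (Pack m u) \<longleftrightarrow> raises k n u"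
| "raises k n (Unpack t u) \<longleftrightarrow> raises k n t \<or> raises k n u"
| "raises k n (Par u v) \<longleftrightarrow> raises (Suc k) n u \<or> raises (Suc k) n v"
| "raises k n (Hyp a P) \<longleftrightarrow> False"
| "raises k n (Wit a P) \<longleftrightarrow> False"
| "raises k n TrueP \<longleftrightarrow> False"
| "raises k n (Rec u v m) \<longleftrightarrow> raises k n u \<or> raises k n v"
| "raises k n (Post us) \<longleftrightarrow> (\<exists>b\<in>set (map (raises k n) us). b)"

text \<open>\<open>winst k n v\<close> is \<open>v[a := n]\<close> for the hypothesis variable \<open>a\<close> with index \<open>k\<close>; the index \<open>k\<close> disappears.
  The clause for \<open>Hyp k P\<close> is irrelevant: in the right-hand side of a typed \<open>Par u v\<close> the bound variable
  occurs only in \<open>Wit\<close>, always with the same annotation up to shifting.\<close>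

primrec winst :: "nat \<Rightarrow> nat \<Rightarrow> pterm \<Rightarrow> pterm" where
  "winst k n (Var x) = Var x"
| "winst k n (App t u) = App (winst k n t) (winst k n u)"
| "winst k n (TApp t m) = TApp (winst k n t) m"
| "winst k n (Lam u) = Lam (winst k n u)"
| "winst k n (TLam u) = TLam (winst k n u)"
| "winst k n (PPair t u) = PPair (winst k n t) (winst k n u)"
| "winst k n (Proj0 u) = Proj0 (winst k n u)"
| "winst k n (Proj1 u) = Proj1 (winst k n u)"
| "winst k n (Inj0 u) = Inj0 (winst k n u)"
| "winst k n (Inj1 u) = Inj1 (winst k n u)"
| "winst k n (Case t u v) = Case (winst k n t) (winst k n u) (winst k n v)"
| "winst k n (Pack m u) = Pack m (winst k n u)"
| "winst k n (Unpack t u) = Unpack (winst k n t) (winst k n u)"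
| "winst k n (Par u v) = Par (winst (Suc k) n u) (winst (Suc k) n v)"
| "winst k n (Hyp a P) = Hyp (if a > k then a - 1 else a) P"
| "winst k n (Wit a P) = (if a = k then Pack (num n) TrueP else Wit (if a > k then a - 1 else a) P)"
| "winst k n TrueP = TrueP"
| "winst k n (Rec u v m) = Rec (winst k n u) (winst k n v) m"
| "winst k n (Post us) = Post (map (winst k n) us)"


section \<open>Typing\<close>

text \<open>The context is split into \<open>\<Gamma>\<close> for the proof variables and \<open>\<Delta>\<close> for the hypothesis variables. Shifting the
  contexts (and \<open>C\<close> in rule \<open>ExE\<close>) expresses the usual side conditions on \<open>\<alpha>\<close>. In rule \<open>EM\<close>,
  that the bound variable occurs in \<open>u\<close> only within \<open>Hyp\<close> and in \<open>v\<close> only within \<open>Wit\<close>, annotated with \<open>P\<close>, is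
  enforced by rules \<open>H\<close> and \<open>W\<close>.\<close>

inductive typed ::
  "(atom list \<Rightarrow> atom \<Rightarrow> bool) \<Rightarrow> fm list \<Rightarrow> fm list \<Rightarrow> pterm \<Rightarrow> fm \<Rightarrow> bool"
  for R :: "atom list \<Rightarrow> atom \<Rightarrow> bool" where
  Ax: "x < length \<Gamma> \<Longrightarrow> typed R \<Gamma> \<Delta> (Var x) (\<Gamma> ! x)"
| H: "a < length \<Delta> \<Longrightarrow> \<Delta> ! a = All (Atm P) \<Longrightarrow> typed R \<Gamma> \<Delta> (Hyp a P) (All (Atm P))"
| W: "a < length \<Delta> \<Longrightarrow> \<Delta> ! a = Ex (Atm (atom_compl P)) \<Longrightarrow>
    typed R \<Gamma> \<Delta> (Wit a P) (Ex (Atm (atom_compl P)))"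
| AndI: "typed R \<Gamma> \<Delta> u A \<Longrightarrow> typed R \<Gamma> \<Delta> v B \<Longrightarrow> typed R \<Gamma> \<Delta> (PPair u v) (And A B)"
| AndE0: "typed R \<Gamma> \<Delta> u (And A B) \<Longrightarrow> typed R \<Gamma> \<Delta> (Proj0 u) A"
| AndE1: "typed R \<Gamma> \<Delta> u (And A B) \<Longrightarrow> typed R \<Gamma> \<Delta> (Proj1 u) B"
| ImpI: "typed R (A # \<Gamma>) \<Delta> u B \<Longrightarrow> typed R \<Gamma> \<Delta> (Lam u) (Imp A B)"
| ImpE: "typed R \<Gamma> \<Delta> t (Imp A B) \<Longrightarrow> typed R \<Gamma> \<Delta> u A \<Longrightarrow> typed R \<Gamma> \<Delta> (App t u) B"
| OrI0: "typed R \<Gamma> \<Delta> u A \<Longrightarrow> typed R \<Gamma> \<Delta> (Inj0 u) (Or A B)"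
| OrI1: "typed R \<Gamma> \<Delta> u B \<Longrightarrow> typed R \<Gamma> \<Delta> (Inj1 u) (Or A B)"
| OrE: "typed R \<Gamma> \<Delta> u (Or A B) \<Longrightarrow> typed R (A # \<Gamma>) \<Delta> v C \<Longrightarrow> typed R (B # \<Gamma>) \<Delta> w C \<Longrightarrow>
    typed R \<Gamma> \<Delta> (Case u v w) C"
| AllI: "typed R (map (fsub shift) \<Gamma>) (map (fsub shift) \<Delta>) u A \<Longrightarrow> typed R \<Gamma> \<Delta> (TLam u) (All A)"
| AllE: "typed R \<Gamma> \<Delta> u (All A) \<Longrightarrow> typed R \<Gamma> \<Delta> (TApp u m) (fsub (inst m) A)"
| ExI: "typed R \<Gamma> \<Delta> u (fsub (inst m) A) \<Longrightarrow> typed R \<Gamma> \<Delta> (Pack m u) (Ex A)"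
| ExE: "typed R \<Gamma> \<Delta> u (Ex A) \<Longrightarrow>
    typed R (A # map (fsub shift) \<Gamma>) (map (fsub shift) \<Delta>) t (fsub shift C) \<Longrightarrow>
    typed R \<Gamma> \<Delta> (Unpack u t) C"
| Ind: "typed R \<Gamma> \<Delta> u (fsub (inst Zero) A) \<Longrightarrow> typed R \<Gamma> \<Delta> v (All (Imp A (fsub step A))) \<Longrightarrow>
    typed R \<Gamma> \<Delta> (Rec u v m) (fsub (inst m) A)"
| PostI: "us \<noteq> [] \<Longrightarrow> R As A \<Longrightarrow> list_all2 (\<lambda>u B. typed R \<Gamma> \<Delta> u (Atm B)) us As \<Longrightarrow>
    typed R \<Gamma> \<Delta> (Post us) (Atm A)"
| PostI0: "R [] A \<Longrightarrow> typed R \<Gamma> \<Delta> TrueP (Atm A)"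
| EM: "typed R \<Gamma> (All (Atm P) # \<Delta>) u (Ex Q) \<Longrightarrow> typed R \<Gamma> (Ex (Atm (atom_compl P)) # \<Delta>) v (Ex Q) \<Longrightarrow>
    neg_prop Q \<Longrightarrow> typed R \<Gamma> \<Delta> (Par u v) (Ex Q)"


section \<open>Reduction\<close>

inductive red :: "pterm \<Rightarrow> pterm \<Rightarrow> bool" (infix "\<mapsto>" 50) where
  beta: "App (Lam u) t \<mapsto> psub (inst_p t) u"
| tbeta: "TApp (TLam u) m \<mapsto> nsub (inst m) u"
| proj0: "Proj0 (PPair u v) \<mapsto> u"
| proj1: "Proj1 (PPair u v) \<mapsto> v"
| case0: "Case (Inj0 u) v w \<mapsto> psub (inst_p u) v"
| case1: "Case (Inj1 u) v w \<mapsto> psub (inst_p u) w"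
| unpack: "Unpack (Pack m u) v \<mapsto> psub (inst_p u) (nsub (inst m) v)"
| rec0: "Rec u v Zero \<mapsto> u"
| recS: "Rec u v (Succ (num n)) \<mapsto> App (TApp v (num n)) (Rec u v (num n))"
| par0: "\<not> hfree 0 u \<Longrightarrow> Par u v \<mapsto> hren (\<lambda>i. i - 1) u"
| par1: "raises 0 n u \<Longrightarrow> Par u v \<mapsto> winst 0 n v"
| hyp: "closed_true (asub (inst (num n)) P) \<Longrightarrow> TApp (Hyp a P) (num n) \<mapsto> TrueP"
| "t \<mapsto> t' \<Longrightarrow> App t u \<mapsto> App t' u"
| "u \<mapsto> u' \<Longrightarrow> App t u \<mapsto> App t u'"
| "t \<mapsto> t' \<Longrightarrow> TApp t m \<mapsto> TApp t' m"
| "u \<mapsto> u' \<Longrightarrow> Lam u \<mapsto> Lam u'"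
| "u \<mapsto> u' \<Longrightarrow> TLam u \<mapsto> TLam u'"
| "t \<mapsto> t' \<Longrightarrow> PPair t u \<mapsto> PPair t' u"
| "u \<mapsto> u' \<Longrightarrow> PPair t u \<mapsto> PPair t u'"
| "u \<mapsto> u' \<Longrightarrow> Proj0 u \<mapsto> Proj0 u'"
| "u \<mapsto> u' \<Longrightarrow> Proj1 u \<mapsto> Proj1 u'"
| "u \<mapsto> u' \<Longrightarrow> Inj0 u \<mapsto> Inj0 u'"
| "u \<mapsto> u' \<Longrightarrow> Inj1 u \<mapsto> Inj1 u'"
| "t \<mapsto> t' \<Longrightarrow> Case t u v \<mapsto> Case t' u v"
| "u \<mapsto> u' \<Longrightarrow> Case t u v \<mapsto> Case t u' v"
| "v \<mapsto> v' \<Longrightarrow> Case t u v \<mapsto> Case t u v'"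
| "u \<mapsto> u' \<Longrightarrow> Pack m u \<mapsto> Pack m u'"
| "t \<mapsto> t' \<Longrightarrow> Unpack t u \<mapsto> Unpack t' u"
| "u \<mapsto> u' \<Longrightarrow> Unpack t u \<mapsto> Unpack t u'"
| "u \<mapsto> u' \<Longrightarrow> Par u v \<mapsto> Par u' v"
| "v \<mapsto> v' \<Longrightarrow> Par u v \<mapsto> Par u v'"
| "u \<mapsto> u' \<Longrightarrow> Rec u v m \<mapsto> Rec u' v m"
| "v \<mapsto> v' \<Longrightarrow> Rec u v m \<mapsto> Rec u v' m"
| "u \<mapsto> u' \<Longrightarrow> Post (us @ u # vs) \<mapsto> Post (us @ u' # vs)"

abbreviation reds :: "pterm \<Rightarrow> pterm \<Rightarrow> bool" (infix "\<mapsto>\<^sup>*" 50) where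
  "t \<mapsto>\<^sup>* t' \<equiv> red\<^sup>*\<^sup>* t t'"

end

theory Submission
  imports Defs
begin

text \<open>By subject reduction it is enough to reduce a closed proof to canonical form. This follows from a
  logical relation that is closed under expansion, so that a reduction strategy may be chosen and
  strong normalization is not needed. The critical case is \<open>Par u v\<close>. By induction \<open>u\<close> evaluates to a
  pair of a numeral and a proof of a negative propositional formula, and at such formulas the relation
  yields full normal forms, also below \<open>Lam\<close>. In a normal form at such a type every
  hypothesis is applied to a numeral, and the instance is false because true instances reduce to
  \<open>TrueP\<close>. So either the hypothesis bound by \<open>Par\<close> does not occur, or it raises an exception with a
  witness for \<open>v\<close>.\<close>


section \<open>Simultaneous substitution\<close>

text \<open>Normal forms below \<open>Lam\<close> make open terms unavoidable. So \<open>val\<close>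
  is indexed by a context for proof variables and is Kripke-like in its weakenings, as in
  normalization by evaluation. The context holds shapes only: free number variables are replaced by
  numerals before evaluation, and a formula has the same shape as its instances. The two sides of
  excluded middle are treated asymmetrically. A universal hypothesis may stay free, since each of
  its numeral instances either computes to \<open>TrueP\<close> or is an acceptable neutral term. An
  existential hypothesis may not, because a free \<open>Wit\<close> never reaches a pair; it always
  receives some number. That number is arbitrary: the right branch evaluates for every
  \<open>n\<close>, and the relation does not record that \<open>n\<close> refutes the hypothesis.
  Correctness of the final witness comes from typing alone, through subject reduction. A further
  obstacle is that the relation is closed under expansion but never shown closed under reduction, so
  a witness normalized inside \<open>Par\<close> has to be put back into the relation from its
  normal form.\<close>

text \<open>All substitutions and renamings on proof terms are instances of a single operation, so that one
  composition lemma covers them. A hypothesis variable \<open>a\<close> is sent to the variable \<open>fst (\<delta> a)\<close>, except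
  that \<open>Wit a P\<close> becomes \<open>Pack (num n) TrueP\<close> if \<open>snd (\<delta> a) = Some n\<close>.\<close>

definition up_d :: "(nat \<Rightarrow> nat \<times> nat option) \<Rightarrow> nat \<Rightarrow> nat \<times> nat option" where
  "up_d \<delta> = case_nat (0, None) (\<lambda>i. (Suc (fst (\<delta> i)), snd (\<delta> i)))"

definition ren_d :: "(nat \<Rightarrow> nat) \<Rightarrow> nat \<Rightarrow> nat \<times> nat option" where
  "ren_d \<eta> = (\<lambda>a. (\<eta> a, None))"

definition wit_d :: "nat \<Rightarrow> nat \<Rightarrow> nat \<Rightarrow> nat \<times> nat option" where
  "wit_d k n = (\<lambda>a. (if a > k then a - 1 else a, if a = k then Some n else None))"

text \<open>A witness chosen by \<open>\<delta>\<close> is final, because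
  \<open>Pack (num n) TrueP\<close> contains no hypothesis variable on which
  \<open>\<delta>'\<close> could act.\<close>

definition comp_d ::
  "(nat \<Rightarrow> nat \<times> nat option) \<Rightarrow> (nat \<Rightarrow> nat \<times> nat option) \<Rightarrow> nat \<Rightarrow> nat \<times> nat option" where
  "comp_d \<delta>' \<delta> = (\<lambda>a. (fst (\<delta>' (fst (\<delta> a))),
    case snd (\<delta> a) of None \<Rightarrow> snd (\<delta>' (fst (\<delta> a))) | Some n \<Rightarrow> Some n))"

primrec sub :: "(nat \<Rightarrow> tm) \<Rightarrow> (nat \<Rightarrow> nat \<times> nat option) \<Rightarrow> (nat \<Rightarrow> pterm) \<Rightarrow> pterm \<Rightarrow> pterm" where
  "sub \<sigma> \<delta> \<theta> (Var x) = \<theta> x"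
| "sub \<sigma> \<delta> \<theta> (App t u) = App (sub \<sigma> \<delta> \<theta> t) (sub \<sigma> \<delta> \<theta> u)"
| "sub \<sigma> \<delta> \<theta> (TApp t m) = TApp (sub \<sigma> \<delta> \<theta> t) (tsub \<sigma> m)"
| "sub \<sigma> \<delta> \<theta> (Lam u) = Lam (sub \<sigma> \<delta> (up_p \<theta>) u)"
| "sub \<sigma> \<delta> \<theta> (TLam u) = TLam (sub (up \<sigma>) \<delta> (up_n \<theta>) u)"
| "sub \<sigma> \<delta> \<theta> (PPair t u) = PPair (sub \<sigma> \<delta> \<theta> t) (sub \<sigma> \<delta> \<theta> u)"
| "sub \<sigma> \<delta> \<theta> (Proj0 u) = Proj0 (sub \<sigma> \<delta> \<theta> u)"
| "sub \<sigma> \<delta> \<theta> (Proj1 u) = Proj1 (sub \<sigma> \<delta> \<theta> u)"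
| "sub \<sigma> \<delta> \<theta> (Inj0 u) = Inj0 (sub \<sigma> \<delta> \<theta> u)"
| "sub \<sigma> \<delta> \<theta> (Inj1 u) = Inj1 (sub \<sigma> \<delta> \<theta> u)"
| "sub \<sigma> \<delta> \<theta> (Case t u v) =
    Case (sub \<sigma> \<delta> \<theta> t) (sub \<sigma> \<delta> (up_p \<theta>) u) (sub \<sigma> \<delta> (up_p \<theta>) v)"
| "sub \<sigma> \<delta> \<theta> (Pack m u) = Pack (tsub \<sigma> m) (sub \<sigma> \<delta> \<theta> u)"
| "sub \<sigma> \<delta> \<theta> (Unpack t u) = Unpack (sub \<sigma> \<delta> \<theta> t) (sub (up \<sigma>) \<delta> (up_p (up_n \<theta>)) u)"
| "sub \<sigma> \<delta> \<theta> (Par u v) = Par (sub \<sigma> (up_d \<delta>) (up_h \<theta>) u) (sub \<sigma> (up_d \<delta>) (up_h \<theta>) v)"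
| "sub \<sigma> \<delta> \<theta> (Hyp a P) = Hyp (fst (\<delta> a)) (asub (up \<sigma>) P)"
| "sub \<sigma> \<delta> \<theta> (Wit a P) = (case snd (\<delta> a) of None \<Rightarrow> Wit (fst (\<delta> a)) (asub (up \<sigma>) P)
    | Some n \<Rightarrow> Pack (num n) TrueP)"
| "sub \<sigma> \<delta> \<theta> TrueP = TrueP"
| "sub \<sigma> \<delta> \<theta> (Rec u v m) = Rec (sub \<sigma> \<delta> \<theta> u) (sub \<sigma> \<delta> \<theta> v) (tsub \<sigma> m)"
| "sub \<sigma> \<delta> \<theta> (Post us) = Post (map (sub \<sigma> \<delta> \<theta>) us)"

section \<open>Identity and composition laws for number substitution\<close>

lemma tsub_TVar [simp]: "tsub TVar t = t"
  by (induction t) auto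

lemma tsub_tsub: "tsub \<sigma> (tsub \<tau> t) = tsub (\<lambda>i. tsub \<sigma> (\<tau> i)) t"
  by (induction t) auto

lemma tsub_num [simp]: "tsub \<sigma> (num n) = num n"
  by (induction n) auto

lemma tfv_num [simp]: "tfv (num n) = {}"
  by (induction n) auto

lemma tsub_inst_shift_var [simp]: "tsub (inst m) (shift i) = TVar i"
  by (simp add: inst_def shift_def)

lemma up_TVar [simp]: "up TVar = TVar"
  by (auto simp: up_def shift_def fun_eq_iff split: nat.splits)

lemma up_comp: "(\<lambda>i. tsub (up \<sigma>) (up \<tau> i)) = up (\<lambda>i. tsub \<sigma> (\<tau> i))"
  by (auto simp: up_def shift_def tsub_tsub fun_eq_iff split: nat.splits)

lemma inst_up: "(\<lambda>i. tsub (inst m) (up \<sigma> i)) = case_nat m \<sigma>"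
  by (auto simp: up_def inst_def shift_def tsub_tsub fun_eq_iff split: nat.splits)

lemma asub_TVar [simp]: "asub TVar A = A"
  by transfer (auto simp: map_idI)

lemma asub_asub: "asub \<sigma> (asub \<tau> A) = asub (\<lambda>i. tsub \<sigma> (\<tau> i)) A"
  by transfer (auto simp: tsub_tsub)

lemma asub_atom_compl: "asub \<sigma> (atom_compl A) = atom_compl (asub \<sigma> A)"
  by transfer auto

lemma fsub_TVar [simp]: "fsub TVar A = A"
  by (induction A) auto

lemma fsub_fsub: "fsub \<sigma> (fsub \<tau> A) = fsub (\<lambda>i. tsub \<sigma> (\<tau> i)) A"
  by (induction A arbitrary: \<sigma> \<tau>) (auto simp: asub_asub up_comp)

section \<open>Renamings, substitutions and \<open>winst\<close> as instances of
  \<open>sub\<close>\<close>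

lemma up_p_Var [simp]: "up_p (\<lambda>i. Var (\<rho> i)) = (\<lambda>i. Var (up_ren \<rho> i))"
  by (auto simp: up_p_def up_ren_def fun_eq_iff split: nat.splits)

lemma up_n_Var [simp]: "up_n (\<lambda>i. Var (\<rho> i)) = (\<lambda>i. Var (\<rho> i))"
  by (auto simp: up_n_def)

lemma up_h_Var [simp]: "up_h (\<lambda>i. Var (\<rho> i)) = (\<lambda>i. Var (\<rho> i))"
  by (auto simp: up_h_def)

lemma up_ren_id [simp]: "up_ren (\<lambda>i. i) = (\<lambda>i. i)"
  by (auto simp: up_ren_def fun_eq_iff split: nat.splits)

lemma up_p_Var' [simp]: "up_p Var = Var"
  using up_p_Var[of "\<lambda>i. i"] by simp

lemma up_n_Var' [simp]: "up_n Var = Var"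
  using up_n_Var[of "\<lambda>i. i"] by simp

lemma up_h_Var' [simp]: "up_h Var = Var"
  using up_h_Var[of "\<lambda>i. i"] by simp

lemma up_d_ren_d [simp]: "up_d (ren_d \<eta>) = ren_d (up_ren \<eta>)"
  by (auto simp: up_d_def ren_d_def up_ren_def fun_eq_iff split: nat.splits)

lemma up_d_wit_d [simp]: "up_d (wit_d k n) = wit_d (Suc k) n"
  by (auto simp: up_d_def wit_d_def fun_eq_iff split: nat.splits)

lemma ren_d_simps [simp]: "fst (ren_d \<eta> a) = \<eta> a" "snd (ren_d \<eta> a) = None"
  by (auto simp: ren_d_def)

lemma pren_eq_sub: "pren \<rho> t = sub TVar (ren_d (\<lambda>a. a)) (\<lambda>i. Var (\<rho> i)) t"
  by (induction t arbitrary: \<rho>) auto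

lemma hren_eq_sub: "hren \<eta> t = sub TVar (ren_d \<eta>) Var t"
  by (induction t arbitrary: \<eta>) auto

lemma nsub_eq_sub: "nsub \<sigma> t = sub \<sigma> (ren_d (\<lambda>a. a)) Var t"
  by (induction t arbitrary: \<sigma>) auto

lemma psub_eq_sub: "psub \<theta> t = sub TVar (ren_d (\<lambda>a. a)) \<theta> t"
  by (induction t arbitrary: \<theta>) auto

lemma winst_eq_sub: "winst k n t = sub TVar (wit_d k n) Var t"
  by (induction t arbitrary: k) (auto simp: wit_d_def up_d_wit_d[unfolded wit_d_def])

lemma nsub_TVar [simp]: "nsub TVar t = t"
  by (induction t) (auto simp: map_idI)

section \<open>Composition laws for proof terms\<close>

lemma comp_d_simps [simp]:
  "fst (comp_d \<delta>' \<delta> a) = fst (\<delta>' (fst (\<delta> a)))"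
  "snd (comp_d \<delta>' \<delta> a) = (case snd (\<delta> a) of None \<Rightarrow> snd (\<delta>' (fst (\<delta> a))) | Some n \<Rightarrow> Some n)"
  by (auto simp: comp_d_def)

lemma sub_id [simp]: "sub TVar (ren_d (\<lambda>a. a)) Var t = t"
  using nsub_eq_sub[of TVar t] by simp

lemma comp_d_ren_d: "comp_d (ren_d \<eta>') (ren_d \<eta>) = ren_d (\<lambda>a. \<eta>' (\<eta> a))"
  by (auto simp: comp_d_def ren_d_def)

lemma comp_d_id [simp]: "comp_d (ren_d (\<lambda>a. a)) \<delta> = \<delta>" "comp_d \<delta> (ren_d (\<lambda>a. a)) = \<delta>"
  by (auto simp: comp_d_def fun_eq_iff prod_eq_iff split: option.splits)

lemma up_d_comp: "comp_d (up_d \<delta>') (up_d \<delta>) = up_d (comp_d \<delta>' \<delta>)"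
  by (auto simp: comp_d_def up_d_def fun_eq_iff split: nat.splits option.splits)

lemma comp_wit_d_up_d: "comp_d (wit_d 0 n) (up_d \<delta>) = case_nat (0, Some n) \<delta>"
  by (auto simp: comp_d_def wit_d_def up_d_def fun_eq_iff prod_eq_iff split: nat.splits option.splits)

lemma up_ren_comp: "(\<lambda>a. up_ren \<rho> (up_ren \<rho>' a)) = up_ren (\<lambda>a. \<rho> (\<rho>' a))"
  by (auto simp: up_ren_def fun_eq_iff split: nat.splits)

lemma pren_pren: "pren \<rho> (pren \<rho>' t) = pren (\<lambda>i. \<rho> (\<rho>' i)) t"
  by (induction t arbitrary: \<rho> \<rho>') (auto simp: up_ren_comp)

lemma hren_hren: "hren \<rho> (hren \<rho>' t) = hren (\<lambda>i. \<rho> (\<rho>' i)) t"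
  by (induction t arbitrary: \<rho> \<rho>') (auto simp: up_ren_comp)

lemma nsub_nsub: "nsub \<sigma> (nsub \<tau> t) = nsub (\<lambda>i. tsub \<sigma> (\<tau> i)) t"
  by (induction t arbitrary: \<sigma> \<tau>) (auto simp: tsub_tsub asub_asub up_comp)

lemma pren_hren: "pren \<rho> (hren \<eta> t) = hren \<eta> (pren \<rho> t)"
  by (induction t arbitrary: \<rho> \<eta>) auto

lemma nsub_pren: "nsub \<sigma> (pren \<rho> t) = pren \<rho> (nsub \<sigma> t)"
  by (induction t arbitrary: \<rho> \<sigma>) auto

lemma nsub_hren: "nsub \<sigma> (hren \<eta> t) = hren \<eta> (nsub \<sigma> t)"
  by (induction t arbitrary: \<eta> \<sigma>) auto

lemma up_p_ren: "(\<lambda>i. up_p \<theta> (up_ren \<rho> i)) = up_p (\<lambda>i. \<theta> (\<rho> i))"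
  by (auto simp: up_p_def up_ren_def fun_eq_iff split: nat.splits)

lemma sub_pren: "sub \<sigma> \<delta> \<theta> (pren \<rho> t) = sub \<sigma> \<delta> (\<lambda>i. \<theta> (\<rho> i)) t"
  by (induction t arbitrary: \<sigma> \<delta> \<theta> \<rho>) (auto simp: up_p_ren up_n_def up_h_def)

lemma sub_nsub: "sub \<sigma> \<delta> \<theta> (nsub \<tau> t) = sub (\<lambda>i. tsub \<sigma> (\<tau> i)) \<delta> \<theta> t"
  by (induction t arbitrary: \<sigma> \<delta> \<theta> \<tau>)
    (auto simp: tsub_tsub asub_asub up_comp split: option.splits)

lemma sub_hren: "sub \<sigma> \<delta> \<theta> (hren \<eta> t) = sub \<sigma> (\<lambda>i. \<delta> (\<eta> i)) \<theta> t"
proof -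
  have "(\<lambda>i. up_d \<delta> (up_ren \<eta> i)) = up_d (\<lambda>i. \<delta> (\<eta> i))" for \<delta> \<eta>
    by (auto simp: up_d_def up_ren_def fun_eq_iff split: nat.splits)
  then show ?thesis
    by (induction t arbitrary: \<sigma> \<delta> \<theta> \<eta>) auto
qed

lemma pren_sub: "pren \<rho> (sub \<sigma> \<delta> \<theta> t) = sub \<sigma> \<delta> (\<lambda>i. pren \<rho> (\<theta> i)) t"
proof -
  have p: "(\<lambda>i. pren (up_ren \<rho>) (up_p \<theta> i)) = up_p (\<lambda>i. pren \<rho> (\<theta> i))" for \<rho> \<theta>
    by (auto simp: up_p_def up_ren_def fun_eq_iff pren_pren split: nat.splits)
  have "(\<lambda>i. pren \<rho> (up_n \<theta> i)) = up_n (\<lambda>i. pren \<rho> (\<theta> i))"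
    "(\<lambda>i. pren \<rho> (up_h \<theta> i)) = up_h (\<lambda>i. pren \<rho> (\<theta> i))" for \<rho> \<theta>
    by (auto simp: up_n_def up_h_def nsub_pren pren_hren)
  with p show ?thesis
    by (induction t arbitrary: \<sigma> \<delta> \<theta> \<rho>) (auto split: option.splits)
qed

lemma hren_sub: "hren \<eta> (sub \<sigma> \<delta> \<theta> t) = sub \<sigma> (comp_d (ren_d \<eta>) \<delta>) (\<lambda>i. hren \<eta> (\<theta> i)) t"
proof -
  have p: "(\<lambda>i. hren \<eta> (up_p \<theta> i)) = up_p (\<lambda>i. hren \<eta> (\<theta> i))"
    "(\<lambda>i. hren \<eta> (up_n \<theta> i)) = up_n (\<lambda>i. hren \<eta> (\<theta> i))"
    "(\<lambda>i. hren (up_ren \<eta>) (up_h \<theta> i)) = up_h (\<lambda>i. hren \<eta> (\<theta> i))" for \<eta> \<theta>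
    by (auto simp: up_p_def up_n_def up_h_def nsub_hren pren_hren hren_hren up_ren_def fun_eq_iff
        split: nat.splits)
  have d: "comp_d (ren_d (up_ren \<eta>)) (up_d \<delta>) = up_d (comp_d (ren_d \<eta>) \<delta>)" for \<eta> \<delta>
    using up_d_comp[of "ren_d \<eta>" \<delta>] by simp
  show ?thesis
    by (induction t arbitrary: \<sigma> \<delta> \<theta> \<eta>) (auto simp: p d split: option.splits)
qed

lemma nsub_sub: "nsub \<tau> (sub \<sigma> \<delta> \<theta> t) = sub (\<lambda>i. tsub \<tau> (\<sigma> i)) \<delta> (\<lambda>i. nsub \<tau> (\<theta> i)) t"
proof -
  have u: "tsub (up \<tau>) (tsub shift m) = tsub shift (tsub \<tau> m)" for \<tau> m
    by (simp add: tsub_tsub shift_def up_def)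
  have p: "(\<lambda>i. nsub \<tau> (up_p \<theta> i)) = up_p (\<lambda>i. nsub \<tau> (\<theta> i))"
    "(\<lambda>i. nsub (up \<tau>) (up_n \<theta> i)) = up_n (\<lambda>i. nsub \<tau> (\<theta> i))"
    "(\<lambda>i. nsub \<tau> (up_h \<theta> i)) = up_h (\<lambda>i. nsub \<tau> (\<theta> i))" for \<tau> \<theta>
    by (auto simp: up_p_def up_n_def up_h_def nsub_hren nsub_pren nsub_nsub fun_eq_iff
        shift_def up_def tsub_tsub split: nat.splits)
  show ?thesis
    by (induction t arbitrary: \<sigma> \<delta> \<theta> \<tau>)
      (auto simp: p up_comp tsub_tsub asub_asub split: option.splits)
qed

text \<open>Binders push a substitution by \<open>up_p\<close>, \<open>up_n\<close> or
  \<open>up_h\<close>, which shift its terms by \<open>pren\<close>, \<open>nsub\<close> or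
  \<open>hren\<close>. The facts \<open>p\<close>, \<open>n\<close> and \<open>h\<close> say that
  pushing respects composition; they rest on the preceding lemmas, which combine \<open>sub\<close>
  with each kind of shift from either side.\<close>

lemma sub_sub:
  "sub \<sigma>' \<delta>' \<theta>' (sub \<sigma> \<delta> \<theta> t) =
    sub (\<lambda>i. tsub \<sigma>' (\<sigma> i)) (comp_d \<delta>' \<delta>) (\<lambda>i. sub \<sigma>' \<delta>' \<theta>' (\<theta> i)) t"
proof -
  have p: "(\<lambda>i. sub \<sigma>' \<delta>' (up_p \<theta>') (up_p \<theta> i)) = up_p (\<lambda>i. sub \<sigma>' \<delta>' \<theta>' (\<theta> i))"
    for \<sigma>' \<delta>' \<theta>' \<theta>
    by (auto simp: up_p_def fun_eq_iff sub_pren pren_sub split: nat.splits)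
  have "(\<lambda>i. tsub (up \<sigma>) (shift i)) = (\<lambda>i. tsub shift (\<sigma> i))" for \<sigma>
    by (simp add: up_def shift_def)
  then have n: "(\<lambda>i. sub (up \<sigma>') \<delta>' (up_n \<theta>') (up_n \<theta> i)) = up_n (\<lambda>i. sub \<sigma>' \<delta>' \<theta>' (\<theta> i))"
    for \<sigma>' \<delta>' \<theta>' \<theta>
    by (simp add: up_n_def sub_nsub nsub_sub)
  have "(\<lambda>i. up_d \<delta> (Suc i)) = comp_d (ren_d Suc) \<delta>" for \<delta>
    by (auto simp: up_d_def comp_d_def fun_eq_iff split: option.splits)
  then have h: "(\<lambda>i. sub \<sigma>' (up_d \<delta>') (up_h \<theta>') (up_h \<theta> i)) = up_h (\<lambda>i. sub \<sigma>' \<delta>' \<theta>' (\<theta> i))"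
    for \<sigma>' \<delta>' \<theta>' \<theta>
    by (simp add: up_h_def sub_hren hren_sub)
  show ?thesis
    by (induction t arbitrary: \<sigma> \<delta> \<theta> \<sigma>' \<delta>' \<theta>')
      (auto simp: p n h up_comp up_d_comp tsub_tsub asub_asub split: option.splits)
qed

section \<open>Contraction of redexes under a substitution\<close>

lemma sub_up_p: "sub TVar (ren_d \<eta>) (case_nat u \<theta>') (sub \<sigma> \<delta> (up_p \<theta>) t) =
    sub \<sigma> (comp_d (ren_d \<eta>) \<delta>) (case_nat u (\<lambda>i. sub TVar (ren_d \<eta>) \<theta>' (\<theta> i))) t"
proof -
  have "(\<lambda>i. sub TVar (ren_d \<eta>) (case_nat u \<theta>') (up_p \<theta> i)) =
      case_nat u (\<lambda>i. sub TVar (ren_d \<eta>) \<theta>' (\<theta> i))"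
    by (auto simp: up_p_def sub_pren fun_eq_iff split: nat.splits)
  then show ?thesis by (simp add: sub_sub)
qed

text \<open>From here to \<open>winst_sub_up_d\<close>: contracting a redex whose body has already
  been substituted yields that body under a longer environment. In this form the induction
  hypotheses of \<open>fundamental\<close> apply to the body.\<close>

lemma psub_inst_p: "psub (inst_p u) (sub \<sigma> \<delta> (up_p \<theta>) t) = sub \<sigma> \<delta> (case_nat u \<theta>) t"
  by (simp add: psub_eq_sub inst_p_def sub_up_p)

lemma nsub_inst: "nsub (inst m) (sub (up \<sigma>) \<delta> (up_n \<theta>) t) = sub (case_nat m \<sigma>) \<delta> \<theta> t"
  by (simp add: nsub_sub inst_up up_n_def nsub_nsub)

lemma psub_nsub_inst:
  "psub (inst_p u) (nsub (inst m) (sub (up \<sigma>) \<delta> (up_p (up_n \<theta>)) t)) =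
    sub (case_nat m \<sigma>) \<delta> (case_nat u \<theta>) t"
proof -
  have "(\<lambda>i. nsub (inst m) (up_p (up_n \<theta>) i)) = up_p \<theta>"
    by (auto simp: up_p_def up_n_def nsub_pren nsub_nsub fun_eq_iff split: nat.splits)
  then show ?thesis by (simp add: nsub_sub inst_up psub_inst_p)
qed

lemma winst_sub_up_d: "winst 0 n (sub \<sigma> (up_d \<delta>) (up_h \<theta>) t) = sub \<sigma> (case_nat (0, Some n) \<delta>) \<theta> t"
proof -
  have "(\<lambda>i. wit_d 0 n (Suc i)) = ren_d (\<lambda>a. a)"
    by (auto simp: wit_d_def ren_d_def)
  then have "(\<lambda>i. sub TVar (wit_d 0 n) Var (up_h \<theta> i)) = \<theta>"
    by (simp add: up_h_def sub_hren)
  then show ?thesis by (simp add: winst_eq_sub sub_sub comp_wit_d_up_d)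
qed

lemma nsub_cong: "\<forall>i\<in>nfv t. \<sigma> i = TVar i \<Longrightarrow> nsub \<sigma> t = t"
proof (induction t arbitrary: \<sigma>)
  have ts: "tsub \<sigma> m = m" if "\<forall>i\<in>tfv m. \<sigma> i = TVar i" for \<sigma> m
    using that by (induction m) auto
  have as: "asub \<sigma> P = P" if "\<forall>i\<in>afv P. \<sigma> i = TVar i" for \<sigma> P
    using that unfolding afv_def by transfer (auto intro!: map_idI ts)
  have up: "\<forall>i\<in>S. up \<sigma> i = TVar i" if "\<forall>i. Suc i \<in> S \<longrightarrow> \<sigma> i = TVar i" for \<sigma> S
    using that by (auto simp: up_def shift_def split: nat.splits)
  {
    case TApp then show ?case by (simp add: ts)
  next
    case TLam then show ?case by (simp add: up)
  next
    case Pack then show ?case by (simp add: ts)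
  next
    case (Unpack t u)
    then have "nsub (up \<sigma>) u = u" by (intro Unpack.IH up) auto
    then show ?case using Unpack by auto
  next
    case Hyp then show ?case by (simp add: as up)
  next
    case Wit then show ?case by (simp add: as up)
  next
    case Rec then show ?case by (simp add: ts)
  next
    case Post then show ?case by (simp add: map_idI)
  }
qed simp_all


section \<open>Subject reduction\<close>

lemma fsub_up_shift: "fsub (up \<sigma>) (fsub shift A) = fsub shift (fsub \<sigma> A)"
  by (simp add: fsub_fsub up_def shift_def)

lemma fsub_inst_shift [simp]: "fsub (inst m) (fsub shift A) = A"
  by (simp add: fsub_fsub)

lemma fsub_inst: "fsub \<sigma> (fsub (inst m) A) = fsub (inst (tsub \<sigma> m)) (fsub (up \<sigma>) A)"
proof -
  have "(\<lambda>i. tsub \<sigma> (inst m i)) = case_nat (tsub \<sigma> m) \<sigma>"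
    by (auto simp: inst_def fun_eq_iff split: nat.splits)
  then show ?thesis by (simp add: fsub_fsub inst_up)
qed

text \<open>\<open>step\<close> changes only the variable 0, which \<open>up \<sigma>\<close> fixes
  and which does not occur in a shifted term, so the two commute.\<close>

lemma fsub_step: "fsub (up \<sigma>) (fsub step A) = fsub step (fsub (up \<sigma>) A)"
proof -
  have "(\<lambda>i. tsub step (shift i)) = shift"
    by (auto simp: step_def shift_def)
  then have "tsub step (tsub shift m) = tsub shift m" for m
    by (simp add: tsub_tsub)
  then have "(\<lambda>i. tsub (up \<sigma>) (step i)) = (\<lambda>i. tsub step (up \<sigma> i))"
    by (auto simp: step_def up_def shift_def fun_eq_iff split: nat.splits)
  then show ?thesis by (simp add: fsub_fsub)
qed

lemma fsub_inst_step: "fsub (inst m) (fsub step A) = fsub (inst (Succ m)) A"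
proof -
  have "(\<lambda>i. tsub (inst m) (step i)) = inst (Succ m)"
    by (auto simp: step_def inst_def shift_def fun_eq_iff split: nat.splits)
  then show ?thesis by (simp add: fsub_fsub)
qed

inductive_cases typed_VarE: "typed R \<Gamma> \<Delta> (Var x) A"
inductive_cases typed_AppE: "typed R \<Gamma> \<Delta> (App t u) A"
inductive_cases typed_TAppE: "typed R \<Gamma> \<Delta> (TApp t m) A"
inductive_cases typed_LamE: "typed R \<Gamma> \<Delta> (Lam t) A"
inductive_cases typed_TLamE: "typed R \<Gamma> \<Delta> (TLam t) A"
inductive_cases typed_PPairE: "typed R \<Gamma> \<Delta> (PPair t u) A"
inductive_cases typed_Proj0E: "typed R \<Gamma> \<Delta> (Proj0 t) A"
inductive_cases typed_Proj1E: "typed R \<Gamma> \<Delta> (Proj1 t) A"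
inductive_cases typed_Inj0E: "typed R \<Gamma> \<Delta> (Inj0 t) A"
inductive_cases typed_Inj1E: "typed R \<Gamma> \<Delta> (Inj1 t) A"
inductive_cases typed_CaseE: "typed R \<Gamma> \<Delta> (Case t u v) A"
inductive_cases typed_PackE: "typed R \<Gamma> \<Delta> (Pack m t) A"
inductive_cases typed_UnpackE: "typed R \<Gamma> \<Delta> (Unpack t u) A"
inductive_cases typed_ParE: "typed R \<Gamma> \<Delta> (Par t u) A"
inductive_cases typed_HypE: "typed R \<Gamma> \<Delta> (Hyp a P) A"
inductive_cases typed_RecE: "typed R \<Gamma> \<Delta> (Rec u v m) A"
inductive_cases typed_PostE: "typed R \<Gamma> \<Delta> (Post us) A"

lemma neg_prop_fsub [simp]: "neg_prop (fsub \<sigma> A) = neg_prop A"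
  by (induction A arbitrary: \<sigma>) auto

lemma typed_AxI: "x < length \<Gamma> \<Longrightarrow> \<Gamma> ! x = A \<Longrightarrow> typed R \<Gamma> \<Delta> (Var x) A"
  using typed.Ax by blast

lemma up_shift_case_nat: "(\<lambda>i. tsub (case_nat (num n) (up \<sigma>)) (up shift i)) = (\<lambda>i. tsub shift (case_nat (num n) \<sigma> i))"
  by (auto simp: up_def shift_def fun_eq_iff split: nat.splits)

section \<open>Preservation of typing under substitution\<close>

definition subst_ok ::
  "(atom list \<Rightarrow> atom \<Rightarrow> bool) \<Rightarrow> pterm set \<Rightarrow> fm list \<Rightarrow> fm list \<Rightarrow> fm list \<Rightarrow> (nat \<Rightarrow> tm) \<Rightarrow>
    (nat \<Rightarrow> pterm) \<Rightarrow> bool" where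
  "subst_ok R K \<Gamma> \<Gamma>' \<Delta>' \<sigma> \<theta> \<longleftrightarrow> (\<forall>x. \<theta> x \<in> K) \<and>
    (\<forall>x<length \<Gamma>. typed R \<Gamma>' \<Delta>' (\<theta> x) (fsub \<sigma> (\<Gamma> ! x)))"

text \<open>A hypothesis either stays, with its formula translated, or is an existential one that
  has received the number \<open>n\<close>; then the instance must be a Post axiom, which types the
  \<open>TrueP\<close> in \<open>Pack (num n) TrueP\<close>. The condition concerns a single index
  so that it can be restricted to indices occurring free, as \<open>par0\<close> requires.\<close>

definition hyp_ok ::
  "(atom list \<Rightarrow> atom \<Rightarrow> bool) \<Rightarrow> fm list \<Rightarrow> fm list \<Rightarrow> (nat \<Rightarrow> tm) \<Rightarrow> (nat \<Rightarrow> nat \<times> nat option) \<Rightarrow>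
    nat \<Rightarrow> bool" where
  "hyp_ok R \<Delta> \<Delta>' \<sigma> \<delta> a \<longleftrightarrow> (case snd (\<delta> a) of
      None \<Rightarrow> fst (\<delta> a) < length \<Delta>' \<and> \<Delta>' ! fst (\<delta> a) = fsub \<sigma> (\<Delta> ! a)
    | Some n \<Rightarrow> \<exists>B. \<Delta> ! a = Ex (Atm B) \<and> R [] (asub (case_nat (num n) \<sigma>) B))"

lemma hyp_ok_up_d:
  "(\<And>i. a = Suc i \<Longrightarrow> hyp_ok R \<Delta> \<Delta>' \<sigma> \<delta> i) \<Longrightarrow>
    hyp_ok R (B # \<Delta>) (fsub \<sigma> B # \<Delta>') \<sigma> (up_d \<delta>) a"
  by (cases a) (auto simp: hyp_ok_def up_d_def split: option.splits)

context arith_post_rules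
begin

text \<open>Under a number binder the instance at the witness is shifted; it remains an axiom
  because the Post rules are schematic.\<close>

lemma hyp_ok_up:
  assumes "hyp_ok R \<Delta> \<Delta>' \<sigma> \<delta> a" "a < length \<Delta>"
  shows "hyp_ok R (map (fsub shift) \<Delta>) (map (fsub shift) \<Delta>') (up \<sigma>) \<delta> a"
proof -
  have "R [] (asub (case_nat (num n) (up \<sigma>)) (asub (up shift) B))"
    if "R [] (asub (case_nat (num n) \<sigma>) B)" for n B
    using schematic[OF that, of shift] by (simp add: asub_asub up_shift_case_nat)
  then show ?thesis
    using assms by (auto simp: hyp_ok_def fsub_up_shift split: option.splits)
qed

text \<open>The weakening lemmas needed for substitution are themselves instances of substitution, where the
  substituted terms are variables. With the set \<open>K\<close> a single induction covers both cases.\<close>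

lemma typed_sub_if_weakening:
  assumes K: "Var 0 \<in> K" "\<And>t. t \<in> K \<Longrightarrow> pren Suc t \<in> K" "\<And>t. t \<in> K \<Longrightarrow> nsub shift t \<in> K"
      "\<And>t. t \<in> K \<Longrightarrow> hren Suc t \<in> K"
    and Kp: "\<And>\<Gamma> \<Delta> t A B. t \<in> K \<Longrightarrow> typed R \<Gamma> \<Delta> t A \<Longrightarrow> typed R (B # \<Gamma>) \<Delta> (pren Suc t) A"
    and Kn: "\<And>\<Gamma> \<Delta> t A. t \<in> K \<Longrightarrow> typed R \<Gamma> \<Delta> t A \<Longrightarrow>
      typed R (map (fsub shift) \<Gamma>) (map (fsub shift) \<Delta>) (nsub shift t) (fsub shift A)"
    and Kh: "\<And>\<Gamma> \<Delta> t A B. t \<in> K \<Longrightarrow> typed R \<Gamma> \<Delta> t A \<Longrightarrow> typed R \<Gamma> (B # \<Delta>) (hren Suc t) A"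
    and t: "typed R \<Gamma> \<Delta> t A"
    and "subst_ok R K \<Gamma> \<Gamma>' \<Delta>' \<sigma> \<theta>"
    and "\<forall>a<length \<Delta>. hfree a t \<longrightarrow> hyp_ok R \<Delta> \<Delta>' \<sigma> \<delta> a"
  shows "typed R \<Gamma>' \<Delta>' (sub \<sigma> \<delta> \<theta> t) (fsub \<sigma> A)"
proof -
  have p: "subst_ok R K (A # \<Gamma>) (fsub \<sigma> A # \<Gamma>') \<Delta>' \<sigma> (up_p \<theta>)"
    if "subst_ok R K \<Gamma> \<Gamma>' \<Delta>' \<sigma> \<theta>" for \<Gamma> \<Gamma>' \<Delta>' \<sigma> \<theta> A
  proof -
    have "up_p \<theta> i \<in> K" for i
      using that K by (cases i) (auto simp: subst_ok_def up_p_def)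
    moreover have "typed R (fsub \<sigma> A # \<Gamma>') \<Delta>' (up_p \<theta> i) (fsub \<sigma> ((A # \<Gamma>) ! i))"
      if "i < length (A # \<Gamma>)" for i
      using that \<open>subst_ok R K \<Gamma> \<Gamma>' \<Delta>' \<sigma> \<theta>\<close> typed.Ax[of 0 "fsub \<sigma> A # \<Gamma>'"]
      by (cases i) (auto simp: subst_ok_def up_p_def intro!: Kp)
    ultimately show ?thesis by (auto simp: subst_ok_def)
  qed
  have n: "subst_ok R K (map (fsub shift) \<Gamma>) (map (fsub shift) \<Gamma>') (map (fsub shift) \<Delta>') (up \<sigma>) (up_n \<theta>)"
    if "subst_ok R K \<Gamma> \<Gamma>' \<Delta>' \<sigma> \<theta>" for \<Gamma> \<Gamma>' \<Delta>' \<sigma> \<theta>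
    using that K by (auto simp: subst_ok_def up_n_def fsub_up_shift intro!: Kn)
  have h: "subst_ok R K \<Gamma> \<Gamma>' (B # \<Delta>') \<sigma> (up_h \<theta>)"
    if "subst_ok R K \<Gamma> \<Gamma>' \<Delta>' \<sigma> \<theta>" for \<Gamma> \<Gamma>' \<Delta>' \<sigma> \<theta> B
    using that K by (auto simp: subst_ok_def up_h_def intro!: Kh)
  show ?thesis
    using t assms(9-)
  proof (induction arbitrary: \<Gamma>' \<Delta>' \<sigma> \<delta> \<theta> rule: typed.induct)
    case (Ax x \<Gamma> \<Delta>)
    then show ?case by (simp add: subst_ok_def)
  next
    case (H a \<Delta> P \<Gamma>)
    then show ?case by (auto simp: hyp_ok_def intro!: typed.H split: option.splits)
  next
    case (W a \<Delta> P \<Gamma>)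
    then have ok: "hyp_ok R \<Delta> \<Delta>' \<sigma> \<delta> a" by simp
    show ?case
    proof (cases "snd (\<delta> a)")
      case None
      then show ?thesis using ok W(2)
        by (auto simp: hyp_ok_def asub_atom_compl intro!: typed.W)
    next
      case (Some n)
      then show ?thesis using ok W(2)
        by (auto simp: hyp_ok_def asub_asub inst_up intro!: typed.ExI typed.PostI0)
    qed
  next
    case (ImpI A \<Gamma> \<Delta> u B)
    then show ?case using p by (auto intro!: typed.ImpI)
  next
    case (AndE0 \<Gamma> \<Delta> u A B)
    from AndE0.IH[OF AndE0.prems(1)] AndE0.prems(2)
    show ?case by (auto intro: typed.AndE0)
  next
    case (AndE1 \<Gamma> \<Delta> u A B)
    from AndE1.IH[OF AndE1.prems(1)] AndE1.prems(2)
    show ?case by (auto intro: typed.AndE1)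
  next
    case (ImpE \<Gamma> \<Delta> t A B u)
    from ImpE.IH(1)[OF ImpE.prems(1)] ImpE.IH(2)[OF ImpE.prems(1)] ImpE.prems(2)
    show ?case by (auto intro: typed.ImpE)
  next
    case (OrE \<Gamma> \<Delta> u A B v C w)
    from OrE.IH(1)[OF OrE.prems(1)] OrE.IH(2)[OF p[OF OrE.prems(1)]]
      OrE.IH(3)[OF p[OF OrE.prems(1)]] OrE.prems(2)
    show ?case by (auto intro!: typed.OrE)
  next
    case (AllI \<Gamma> \<Delta> u A)
    from AllI.IH[OF n[OF AllI.prems(1)]] AllI.prems(2)
    show ?case by (auto intro!: typed.AllI hyp_ok_up)
  next
    case (AllE \<Gamma> \<Delta> u A m)
    then show ?case by (auto simp: fsub_inst intro!: typed.AllE)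
  next
    case (ExI \<Gamma> \<Delta> u m A)
    then show ?case by (auto simp: fsub_inst intro!: typed.ExI)
  next
    case (ExE \<Gamma> \<Delta> u A t C)
    from ExE.IH(1)[OF ExE.prems(1)] ExE.IH(2)[OF p[OF n[OF ExE.prems(1)]]] ExE.prems(2)
    show ?case by (auto intro!: typed.ExE hyp_ok_up simp: fsub_up_shift)
  next
    case (Ind \<Gamma> \<Delta> u A v m)
    then show ?case by (auto simp: fsub_inst fsub_step intro!: typed.Ind)
  next
    case (PostI us As A \<Gamma> \<Delta>)
    have hyps: "\<forall>u\<in>set us. \<forall>a<length \<Delta>. hfree a u \<longrightarrow> hyp_ok R \<Delta> \<Delta>' \<sigma> \<delta> a"
      using PostI.prems by auto
    have "list_all2 (\<lambda>u B. typed R \<Gamma>' \<Delta>' (sub \<sigma> \<delta> \<theta> u) (fsub \<sigma> (Atm B))) us As"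
      by (rule list.rel_mono_strong[OF PostI.IH]) (use PostI.prems(1) hyps in blast)
    then show ?case using PostI.hyps schematic
      by (auto simp: list_all2_map1 list_all2_map2 intro!: typed.PostI)
  next
    case (PostI0 A \<Gamma> \<Delta>)
    then show ?case using schematic[of "[]"] by (auto intro: typed.PostI0)
  next
    case (EM \<Gamma> P \<Delta> u Q v)
    have hyps: "\<forall>a<length (B # \<Delta>). hfree a w \<longrightarrow> hyp_ok R (B # \<Delta>) (fsub \<sigma> B # \<Delta>') \<sigma> (up_d \<delta>) a"
      if "w = u \<or> w = v" for w B
      by (intro allI impI hyp_ok_up_d) (use EM.prems(2) that in auto)
    have "typed R \<Gamma>' (fsub \<sigma> (All (Atm P)) # \<Delta>') (sub \<sigma> (up_d \<delta>) (up_h \<theta>) u) (fsub \<sigma> (Ex Q))"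
      by (intro EM.IH(1) h EM.prems(1) hyps) simp
    moreover have "typed R \<Gamma>' (fsub \<sigma> (Ex (Atm (atom_compl P))) # \<Delta>')
        (sub \<sigma> (up_d \<delta>) (up_h \<theta>) v) (fsub \<sigma> (Ex Q))"
      by (intro EM.IH(2) h EM.prems(1) hyps) simp
    ultimately show ?case by (simp add: asub_atom_compl EM.hyps typed.EM)
  qed (auto intro: typed.intros)
qed

lemma typed_ren:
  assumes "typed R \<Gamma> \<Delta> t A"
    and "\<forall>x<length \<Gamma>. \<rho> x < length \<Gamma>' \<and> \<Gamma>' ! \<rho> x = fsub \<sigma> (\<Gamma> ! x)"
    and "\<forall>a<length \<Delta>. \<eta> a < length \<Delta>' \<and> \<Delta>' ! \<eta> a = fsub \<sigma> (\<Delta> ! a)"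
  shows "typed R \<Gamma>' \<Delta>' (sub \<sigma> (ren_d \<eta>) (\<lambda>i. Var (\<rho> i)) t) (fsub \<sigma> A)"
proof (rule typed_sub_if_weakening[of "range Var", OF _ _ _ _ _ _ _ assms(1)])
  show "subst_ok R (range Var) \<Gamma> \<Gamma>' \<Delta>' \<sigma> (\<lambda>i. Var (\<rho> i))"
    using assms(2) by (auto simp: subst_ok_def intro: typed_AxI)
  show "\<forall>a<length \<Delta>. hfree a t \<longrightarrow> hyp_ok R \<Delta> \<Delta>' \<sigma> (ren_d \<eta>) a"
    using assms(3) by (auto simp: hyp_ok_def)
qed (auto elim!: typed_VarE intro!: typed_AxI)

lemma typed_sub:
  assumes "typed R \<Gamma> \<Delta> t A"
    and "\<forall>x<length \<Gamma>. typed R \<Gamma>' \<Delta>' (\<theta> x) (fsub \<sigma> (\<Gamma> ! x))"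
    and "\<forall>a<length \<Delta>. hfree a t \<longrightarrow> hyp_ok R \<Delta> \<Delta>' \<sigma> \<delta> a"
  shows "typed R \<Gamma>' \<Delta>' (sub \<sigma> \<delta> \<theta> t) (fsub \<sigma> A)"
proof (rule typed_sub_if_weakening[of UNIV, OF _ _ _ _ _ _ _ assms(1)])
  fix \<Gamma> \<Delta> t A B
  assume t: "typed R \<Gamma> \<Delta> t A"
  show "typed R (B # \<Gamma>) \<Delta> (pren Suc t) A"
    using typed_ren[OF t, of Suc "B # \<Gamma>" TVar "\<lambda>a. a" \<Delta>] by (simp add: pren_eq_sub)
  show "typed R \<Gamma> (B # \<Delta>) (hren Suc t) A"
    using typed_ren[OF t, of "\<lambda>x. x" \<Gamma> TVar Suc "B # \<Delta>"] by (simp add: hren_eq_sub)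
  show "typed R (map (fsub shift) \<Gamma>) (map (fsub shift) \<Delta>) (nsub shift t) (fsub shift A)"
    using typed_ren[OF t, of "\<lambda>x. x" "map (fsub shift) \<Gamma>" shift "\<lambda>x. x" "map (fsub shift) \<Delta>"]
    by (simp add: nsub_eq_sub)
qed (use assms in \<open>auto simp: subst_ok_def\<close>)

lemma typed_psub_inst_p:
  assumes "typed R (B # \<Gamma>) \<Delta> t A" "typed R \<Gamma> \<Delta> u B"
  shows "typed R \<Gamma> \<Delta> (psub (inst_p u) t) A"
proof -
  have "typed R \<Gamma> \<Delta> (inst_p u x) (fsub TVar ((B # \<Gamma>) ! x))" if "x < length (B # \<Gamma>)" for x
    using assms(2) that by (cases x) (auto simp: inst_p_def intro: typed.Ax)
  then show ?thesis
    using typed_sub[OF assms(1), of \<Gamma> \<Delta> "inst_p u" TVar "ren_d (\<lambda>a. a)"]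
    by (simp add: psub_eq_sub hyp_ok_def)
qed

lemma typed_nsub_inst:
  assumes "typed R (map (fsub shift) \<Gamma>) (map (fsub shift) \<Delta>) t A"
  shows "typed R \<Gamma> \<Delta> (nsub (inst m) t) (fsub (inst m) A)"
  using typed_ren[OF assms, of "\<lambda>x. x" \<Gamma> "inst m" "\<lambda>x. x" \<Delta>] by (simp add: nsub_eq_sub)

section \<open>Exceptions raised by typed terms\<close>

lemma afv_asub_shift: "afv (asub shift A) = Suc ` afv A"
proof -
  have t: "tfv (tsub shift t) = Suc ` tfv t" for t
    by (induction t) (auto simp: shift_def)
  show ?thesis unfolding afv_def by transfer (force simp: t)
qed

lemma closed_false_asub_shift: "closed_false (asub shift A) \<longleftrightarrow> closed_false A"
proof -
  have "\<exists>e'. e = (\<lambda>i. tval e' (shift i))" for e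
    \<comment> \<open>Moving the environment up by one index lets \<open>shift\<close> look up the
      original values; the value at 0 is a filler.\<close>
    by (rule exI[of _ "\<lambda>i. e (i - 1)"]) (simp add: shift_def)
  then show ?thesis
    unfolding closed_false_def afv_asub_shift holds_asub by (metis image_is_empty)
qed

text \<open>Below number binders the annotation of \<open>Hyp\<close> is a shifted copy of the
  formula declared in the context. Its refuted instance is closed, so undoing the shift does not
  affect falsity; \<open>*\<close> undoes one shift for \<open>AllI\<close> and
  \<open>ExE\<close>.\<close>

lemma typed_raises:
  assumes "typed R \<Gamma> \<Delta> t A" "raises k n t" "k < length \<Delta>"
  shows "\<exists>P. \<Delta> ! k = All (Atm P) \<and> closed_false (asub (inst (num n)) P)"
  using assms
proof (induction arbitrary: k rule: typed.induct)
  have *: "\<exists>P. \<Delta> ! k = All (Atm P) \<and> closed_false (asub (inst (num n)) P)"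
    if "\<exists>P. map (fsub shift) \<Delta> ! k = All (Atm P) \<and> closed_false (asub (inst (num n)) P)"
      "k < length \<Delta>" for \<Delta> k
  proof -
    from that obtain P where P: "fsub shift (\<Delta> ! k) = All (Atm P)"
      "closed_false (asub (inst (num n)) P)"
      by auto
    then obtain B where "\<Delta> ! k = All B" "fsub (up shift) B = Atm P"
      by (cases "\<Delta> ! k") auto
    then obtain P' where P': "\<Delta> ! k = All (Atm P')" "P = asub (up shift) P'"
      by (cases B) auto
    have "(\<lambda>i. tsub (inst (num n)) (up shift i)) = (\<lambda>i. tsub shift (inst (num n) i))"
      by (auto simp: inst_def up_def shift_def fun_eq_iff split: nat.splits)
    then have "asub (inst (num n)) P = asub shift (asub (inst (num n)) P')"
      by (simp add: asub_asub P')
    then show ?thesis using P' P(2) closed_false_asub_shift by auto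
  qed
  {
    case (AllI \<Gamma> \<Delta> u A)
    then show ?case using * by auto
  next
    case (AllE \<Gamma> \<Delta> u A m)
    then show ?case by (auto elim!: typed_HypE)
  next
    case (ExE \<Gamma> \<Delta> u A t C)
    then show ?case using * by auto
  next
    case (PostI us As A \<Gamma> \<Delta>)
    then show ?case by (auto simp: list_all2_conv_all_nth in_set_conv_nth)
  next
    case (EM \<Gamma> P \<Delta> u Q v)
    then show ?case by force
  }
qed auto

lemma closed_true_atom_compl: "closed_false A \<Longrightarrow> closed_true (atom_compl A)"
  by (simp add: closed_false_def closed_true_def holds_atom_compl afv_def args_atom_compl)

section \<open>Preservation of typing under reduction\<close>

lemma typed_Post_step:
  assumes "typed R \<Gamma> \<Delta> (Post (us @ u # vs)) A" "\<And>B. typed R \<Gamma> \<Delta> u B \<Longrightarrow> typed R \<Gamma> \<Delta> u' B"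
  shows "typed R \<Gamma> \<Delta> (Post (us @ u' # vs)) A"
proof -
  from assms(1) obtain As B where A: "A = Atm B" "R As B"
    and As: "list_all2 (\<lambda>u B. typed R \<Gamma> \<Delta> u (Atm B)) (us @ u # vs) As"
    by (auto elim!: typed_PostE)
  from As assms(2) have "list_all2 (\<lambda>u B. typed R \<Gamma> \<Delta> u (Atm B)) (us @ u' # vs) As"
    by (fastforce simp: list_all2_append1 list_all2_Cons1)
  with A show ?thesis by (auto intro: typed.PostI)
qed

theorem subject_reduction: "t \<mapsto> t' \<Longrightarrow> typed R \<Gamma> \<Delta> t A \<Longrightarrow> typed R \<Gamma> \<Delta> t' A"
proof (induction arbitrary: \<Gamma> \<Delta> A rule: red.induct)
  case (beta u t)
  then show ?case by (auto elim!: typed_AppE typed_LamE intro: typed_psub_inst_p)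
next
  case (tbeta u m)
  then show ?case by (auto elim!: typed_TAppE typed_TLamE intro: typed_nsub_inst)
next
  case (case0 u v w)
  then show ?case by (auto elim!: typed_CaseE typed_Inj0E intro: typed_psub_inst_p)
next
  case (case1 u v w)
  then show ?case by (auto elim!: typed_CaseE typed_Inj1E intro: typed_psub_inst_p)
next
  case (unpack m u v)
  then obtain B where u: "typed R \<Gamma> \<Delta> u (fsub (inst m) B)"
    and v: "typed R (B # map (fsub shift) \<Gamma>) (map (fsub shift) \<Delta>) v (fsub shift A)"
    by (auto elim!: typed_UnpackE typed_PackE)
  let ?\<Gamma> = "fsub (inst m) B # \<Gamma>"
  \<comment> \<open>The number is substituted first, in the context already extended by the instance
    of \<open>B\<close>; \<open>typed_psub_inst_p\<close> then removes the proof variable. This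
    matches the order of the substitutions in \<open>unpack\<close>.\<close>
  have "typed R ?\<Gamma> \<Delta> (sub (inst m) (ren_d (\<lambda>a. a)) (\<lambda>i. Var i) v) (fsub (inst m) (fsub shift A))"
    by (rule typed_ren[OF v]) (auto simp: nth_Cons split: nat.splits)
  then show ?case using u by (auto simp: nsub_eq_sub intro: typed_psub_inst_p)
next
  case (rec0 u v)
  then show ?case by (auto elim!: typed_RecE)
next
  case (recS u v n)
  then obtain B where B: "A = fsub (inst (Succ (num n))) B" "typed R \<Gamma> \<Delta> u (fsub (inst Zero) B)"
    "typed R \<Gamma> \<Delta> v (All (Imp B (fsub step B)))"
    by (auto elim!: typed_RecE)
  then show ?case
    using typed.AllE[OF B(3), of "num n"] typed.Ind[OF B(2,3), of "num n"]
    by (auto simp: fsub_inst_step intro: typed.ImpE)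
next
  case (par0 u v)
  then obtain B where u: "typed R \<Gamma> (B # \<Delta>) u A"
    by (auto elim!: typed_ParE)
  \<comment> \<open>The renaming sends the bound index 0 to 0, where the formulas need not agree;
    this is harmless because \<open>hyp_ok\<close> is required only at indices occurring free in
    \<open>u\<close>.\<close>
  have "typed R \<Gamma> \<Delta> (sub TVar (ren_d (\<lambda>i. i - 1)) Var u) (fsub TVar A)"
    by (rule typed_sub[OF u]) (use par0.hyps in \<open>auto simp: hyp_ok_def nth_Cons intro: typed.Ax split: nat.splits\<close>)
  then show ?case by (simp add: hren_eq_sub)
next
  case (par1 n u v)
  then obtain P where u: "typed R \<Gamma> (All (Atm P) # \<Delta>) u A"
    and v: "typed R \<Gamma> (Ex (Atm (atom_compl P)) # \<Delta>) v A"
    by (auto elim!: typed_ParE)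
  \<comment> \<open>Falsity of the closed instance makes its complement an axiom by
    \<open>bool\<close>. So \<open>TrueP\<close> proves what \<open>Wit\<close> promised, which is
    \<open>hyp_ok\<close> at index 0.\<close>
  have "R [] (atom_compl (asub (inst (num n)) P))"
    using typed_raises[OF u par1.hyps] by (auto intro: bool closed_true_atom_compl)
  then have "typed R \<Gamma> \<Delta> (sub TVar (wit_d 0 n) Var v) (fsub TVar A)"
    by (intro typed_sub[OF v])
      (auto simp: hyp_ok_def wit_d_def nth_Cons asub_atom_compl inst_def intro: typed.Ax split: nat.splits)
  then show ?case by (simp add: winst_eq_sub)
next
  case (hyp n P a)
  then show ?case by (auto elim!: typed_TAppE typed_HypE intro!: typed.PostI0 bool)
qed (auto simp: typed_Post_step elim!: typed_AppE typed_TAppE typed_LamE typed_TLamE typed_PPairE typed_Proj0E typed_Proj1E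
    typed_Inj0E typed_Inj1E typed_CaseE typed_PackE typed_UnpackE typed_ParE typed_RecE intro: typed.intros)

lemma subject_reduction_reds: "t \<mapsto>\<^sup>* t' \<Longrightarrow> typed R \<Gamma> \<Delta> t A \<Longrightarrow> typed R \<Gamma> \<Delta> t' A"
  by (induction rule: rtranclp_induct) (auto intro: subject_reduction)

end


section \<open>Normal forms of negative propositional type\<close>

text \<open>Only the shape of a formula matters for the computational behaviour of its proofs.\<close>

datatype shape = SAtm | SAnd shape shape | SOr shape shape | SImp shape shape | SAll shape | SEx shape

primrec shape_of :: "fm \<Rightarrow> shape" where
  "shape_of (Atm P) = SAtm"
| "shape_of (And A B) = SAnd (shape_of A) (shape_of B)"
| "shape_of (Or A B) = SOr (shape_of A) (shape_of B)"
| "shape_of (Imp A B) = SImp (shape_of A) (shape_of B)"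
| "shape_of (All A) = SAll (shape_of A)"
| "shape_of (Ex A) = SEx (shape_of A)"

primrec neg_shape :: "shape \<Rightarrow> bool" where
  "neg_shape SAtm \<longleftrightarrow> True"
| "neg_shape (SAnd A B) \<longleftrightarrow> neg_shape A \<and> neg_shape B"
| "neg_shape (SOr A B) \<longleftrightarrow> False"
| "neg_shape (SImp A B) \<longleftrightarrow> neg_shape A \<and> neg_shape B"
| "neg_shape (SAll A) \<longleftrightarrow> False"
| "neg_shape (SEx A) \<longleftrightarrow> False"

lemma shape_of_fsub [simp]: "shape_of (fsub \<sigma> A) = shape_of A"
  by (induction A arbitrary: \<sigma>) auto

lemma neg_shape_shape_of [simp]: "neg_shape (shape_of A) = neg_prop A"
  by (induction A) auto

text \<open>The usual neutral and normal terms, not eta-long, with a false instance of a hypothesis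
  as an additional neutral head. Since \<open>ne_Var\<close> admits negative shapes only, no neutral
  term proves a disjunction or an existential formula, and stuck \<open>Case\<close> and
  \<open>Unpack\<close> need no clause.\<close>

inductive ne :: "shape list \<Rightarrow> pterm \<Rightarrow> shape \<Rightarrow> bool"
  and nf :: "shape list \<Rightarrow> pterm \<Rightarrow> shape \<Rightarrow> bool" where
  ne_Var: "x < length \<Gamma> \<Longrightarrow> neg_shape (\<Gamma> ! x) \<Longrightarrow> ne \<Gamma> (Var x) (\<Gamma> ! x)"
| ne_App: "ne \<Gamma> t (SImp A B) \<Longrightarrow> nf \<Gamma> u A \<Longrightarrow> ne \<Gamma> (App t u) B"
| ne_Proj0: "ne \<Gamma> t (SAnd A B) \<Longrightarrow> ne \<Gamma> (Proj0 t) A"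
| ne_Proj1: "ne \<Gamma> t (SAnd A B) \<Longrightarrow> ne \<Gamma> (Proj1 t) B"
| ne_Hyp: "closed_false (asub (inst (num n)) P) \<Longrightarrow> ne \<Gamma> (TApp (Hyp a P) (num n)) SAtm"
| nf_ne: "ne \<Gamma> t A \<Longrightarrow> nf \<Gamma> t A"
| nf_Lam: "nf (A # \<Gamma>) t B \<Longrightarrow> nf \<Gamma> (Lam t) (SImp A B)"
| nf_PPair: "nf \<Gamma> t A \<Longrightarrow> nf \<Gamma> u B \<Longrightarrow> nf \<Gamma> (PPair t u) (SAnd A B)"
| nf_TrueP: "nf \<Gamma> TrueP SAtm"
| nf_Post: "\<forall>u\<in>set us. nf \<Gamma> u SAtm \<Longrightarrow> nf \<Gamma> (Post us) SAtm"

lemma ne_neg_shape: "ne \<Gamma> t A \<Longrightarrow> neg_shape A"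
  by (induction rule: ne_nf.inducts(1)[where ?P2.0 = "\<lambda>_ _ _. True"]) auto

text \<open>\<open>ne_Hyp\<close> is the only clause that mentions a hypothesis variable, and it has
  exactly the form that \<open>raises\<close> looks for.\<close>

lemma nf_hfree_raises:
  "ne \<Gamma> t A \<Longrightarrow> hfree k t \<Longrightarrow> \<exists>n. raises k n t"
  "nf \<Gamma> t A \<Longrightarrow> hfree k t \<Longrightarrow> \<exists>n. raises k n t"
  by (induction rule: ne_nf.inducts) fastforce+

section \<open>Weakening\<close>

definition ren_ok :: "(nat \<Rightarrow> nat) \<Rightarrow> shape list \<Rightarrow> shape list \<Rightarrow> bool" where
  "ren_ok \<rho> \<Gamma> \<Gamma>' \<longleftrightarrow> (\<forall>x<length \<Gamma>. \<rho> x < length \<Gamma>' \<and> \<Gamma>' ! \<rho> x = \<Gamma> ! x)"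

lemma ren_ok_id [simp]: "ren_ok (\<lambda>x. x) \<Gamma> \<Gamma>"
  by (simp add: ren_ok_def)

lemma ren_ok_Suc [simp]: "ren_ok Suc \<Gamma> (A # \<Gamma>)"
  by (simp add: ren_ok_def)

lemma ren_ok_comp: "ren_ok \<rho> \<Gamma> \<Gamma>' \<Longrightarrow> ren_ok \<rho>' \<Gamma>' \<Gamma>'' \<Longrightarrow> ren_ok (\<lambda>x. \<rho>' (\<rho> x)) \<Gamma> \<Gamma>''"
  by (simp add: ren_ok_def)

lemma ren_ok_up_ren: "ren_ok \<rho> \<Gamma> \<Gamma>' \<Longrightarrow> ren_ok (up_ren \<rho>) (A # \<Gamma>) (A # \<Gamma>')"
  by (auto simp: ren_ok_def up_ren_def nth_Cons split: nat.splits)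

text \<open>Hypothesis variables have no context on the level of shapes, so \<open>\<eta>\<close> is
  unconstrained. It may in particular lower indices, as happens when \<open>Par\<close>
  disappears.\<close>

definition wk :: "(nat \<Rightarrow> nat) \<Rightarrow> (nat \<Rightarrow> nat) \<Rightarrow> pterm \<Rightarrow> pterm" where
  "wk \<rho> \<eta> t = sub TVar (ren_d \<eta>) (\<lambda>i. Var (\<rho> i)) t"

lemma wk_id [simp]: "wk (\<lambda>x. x) (\<lambda>a. a) t = t"
  by (simp add: wk_def)

lemma wk_wk: "wk \<rho>' \<eta>' (wk \<rho> \<eta> t) = wk (\<lambda>x. \<rho>' (\<rho> x)) (\<lambda>a. \<eta>' (\<eta> a)) t"
  by (simp add: wk_def sub_sub comp_d_ren_d)

lemma wk_sub: "wk \<rho> \<eta> (sub \<sigma> \<delta> \<theta> t) = sub \<sigma> (comp_d (ren_d \<eta>) \<delta>) (\<lambda>i. wk \<rho> \<eta> (\<theta> i)) t"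
  by (simp add: wk_def sub_sub)

lemma nf_wk:
  "ne \<Gamma> t A \<Longrightarrow> ren_ok \<rho> \<Gamma> \<Gamma>' \<Longrightarrow> ne \<Gamma>' (wk \<rho> \<eta> t) A"
  "nf \<Gamma> t A \<Longrightarrow> ren_ok \<rho> \<Gamma> \<Gamma>' \<Longrightarrow> nf \<Gamma>' (wk \<rho> \<eta> t) A"
proof (induction arbitrary: \<Gamma>' \<rho> and \<Gamma>' \<rho> rule: ne_nf.inducts)
  case (ne_Var x \<Gamma>)
  then show ?case using ne_nf.ne_Var[of "\<rho> x" \<Gamma>'] by (auto simp: wk_def ren_ok_def)
next
  case (ne_App \<Gamma> t A B u)
  then show ?case using ne_nf.ne_App[of \<Gamma>' "wk \<rho> \<eta> t" A B] by (simp add: wk_def)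
next
  case (nf_Post us \<Gamma>)
  then show ?case by (auto simp: wk_def intro!: ne_nf.nf_Post)
next
  case (nf_Lam A \<Gamma> t B)
  then show ?case by (auto simp: wk_def ren_ok_up_ren intro!: ne_nf.nf_Lam)
qed (auto simp: wk_def intro: ne_nf.intros)


section \<open>A logical relation\<close>

lemma reds_cong:
  assumes "\<And>t t'. t \<mapsto> t' \<Longrightarrow> C t \<mapsto> C t'" "t \<mapsto>\<^sup>* t'"
  shows "C t \<mapsto>\<^sup>* C t'"
  using assms(2) by (induction rule: rtranclp_induct) (auto intro: assms(1) rtranclp.rtrancl_into_rtrancl)

lemma reds_AppL: "t \<mapsto>\<^sup>* t' \<Longrightarrow> App t u \<mapsto>\<^sup>* App t' u"
  by (rule reds_cong[of "\<lambda>t. App t u"]) (erule red.intros)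

lemma reds_AppR: "t \<mapsto>\<^sup>* t' \<Longrightarrow> App u t \<mapsto>\<^sup>* App u t'"
  by (rule reds_cong[of "\<lambda>t. App u t"]) (erule red.intros)

lemma reds_TApp: "t \<mapsto>\<^sup>* t' \<Longrightarrow> TApp t m \<mapsto>\<^sup>* TApp t' m"
  by (rule reds_cong[of "\<lambda>t. TApp t m"]) (erule red.intros)

lemma reds_Lam: "t \<mapsto>\<^sup>* t' \<Longrightarrow> Lam t \<mapsto>\<^sup>* Lam t'"
  by (rule reds_cong[of "\<lambda>t. Lam t"]) (erule red.intros)

lemma reds_PPairL: "t \<mapsto>\<^sup>* t' \<Longrightarrow> PPair t u \<mapsto>\<^sup>* PPair t' u"
  by (rule reds_cong[of "\<lambda>t. PPair t u"]) (erule red.intros)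

lemma reds_PPairR: "t \<mapsto>\<^sup>* t' \<Longrightarrow> PPair u t \<mapsto>\<^sup>* PPair u t'"
  by (rule reds_cong[of "\<lambda>t. PPair u t"]) (erule red.intros)

lemma reds_Proj0: "t \<mapsto>\<^sup>* t' \<Longrightarrow> Proj0 t \<mapsto>\<^sup>* Proj0 t'"
  by (rule reds_cong[of "\<lambda>t. Proj0 t"]) (erule red.intros)

lemma reds_Proj1: "t \<mapsto>\<^sup>* t' \<Longrightarrow> Proj1 t \<mapsto>\<^sup>* Proj1 t'"
  by (rule reds_cong[of "\<lambda>t. Proj1 t"]) (erule red.intros)

lemma reds_Case: "t \<mapsto>\<^sup>* t' \<Longrightarrow> Case t u v \<mapsto>\<^sup>* Case t' u v"
  by (rule reds_cong[of "\<lambda>t. Case t u v"]) (erule red.intros)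

lemma reds_Pack: "t \<mapsto>\<^sup>* t' \<Longrightarrow> Pack m t \<mapsto>\<^sup>* Pack m t'"
  by (rule reds_cong[of "\<lambda>t. Pack m t"]) (erule red.intros)

lemma reds_Unpack: "t \<mapsto>\<^sup>* t' \<Longrightarrow> Unpack t u \<mapsto>\<^sup>* Unpack t' u"
  by (rule reds_cong[of "\<lambda>t. Unpack t u"]) (erule red.intros)

lemma reds_Par: "t \<mapsto>\<^sup>* t' \<Longrightarrow> Par t u \<mapsto>\<^sup>* Par t' u"
  by (rule reds_cong[of "\<lambda>t. Par t u"]) (erule red.intros)

lemma reds_Post1: "t \<mapsto>\<^sup>* t' \<Longrightarrow> Post (us @ t # vs) \<mapsto>\<^sup>* Post (us @ t' # vs)"
  by (rule reds_cong[of "\<lambda>t. Post (us @ t # vs)"]) (erule red.intros)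

lemma reds_App: "t \<mapsto>\<^sup>* t' \<Longrightarrow> u \<mapsto>\<^sup>* u' \<Longrightarrow> App t u \<mapsto>\<^sup>* App t' u'"
  by (rule rtranclp_trans[OF reds_AppL reds_AppR])

lemma reds_PPair: "t \<mapsto>\<^sup>* t' \<Longrightarrow> u \<mapsto>\<^sup>* u' \<Longrightarrow> PPair t u \<mapsto>\<^sup>* PPair t' u'"
  by (rule rtranclp_trans[OF reds_PPairL reds_PPairR])

text \<open>The prefix \<open>vs\<close> collects the arguments that have already been reduced, from
  left to right.\<close>

lemma reds_Post: "list_all2 reds us us' \<Longrightarrow> Post (vs @ us) \<mapsto>\<^sup>* Post (vs @ us')"
proof (induction arbitrary: vs rule: list_all2_induct)
  case (Cons u us u' us')
  have "Post (vs @ u # us) \<mapsto>\<^sup>* Post (vs @ u' # us)"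
    by (rule reds_Post1[OF Cons.hyps(1)])
  moreover have "Post ((vs @ [u']) @ us) \<mapsto>\<^sup>* Post ((vs @ [u']) @ us')"
    by (rule Cons.IH)
  ultimately show ?case by simp
qed simp

text \<open>Closure under weakening is built into the relation where it is needed and never derived from
  stability of reduction under renaming: on untyped terms the latter fails, because of the
  irrelevant clause of \<open>winst\<close> for \<open>Hyp\<close>.\<close>

definition stably :: "(shape list \<Rightarrow> pterm \<Rightarrow> bool) \<Rightarrow> shape list \<Rightarrow> pterm \<Rightarrow> bool" where
  "stably X \<Gamma> t \<longleftrightarrow> (\<forall>\<Gamma>' \<rho> \<eta>. ren_ok \<rho> \<Gamma> \<Gamma>' \<longrightarrow> X \<Gamma>' (wk \<rho> \<eta> t))"

text \<open>Neutral terms have negative shape, so only conjunction and implication need a separate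
  neutral alternative; at \<open>SAtm\<close> it is contained in \<open>nf\<close>.
  \<open>SAll\<close> does not ask for a \<open>TLam\<close>, so that \<open>Hyp\<close>, which is
  no abstraction, can inhabit it. In \<open>SImp\<close> the renaming \<open>\<rho>\<close> allows
  arguments from a larger context, in particular a fresh variable.\<close>

primrec val :: "shape \<Rightarrow> shape list \<Rightarrow> pterm \<Rightarrow> bool" where
  "val SAtm \<Gamma> t \<longleftrightarrow> (\<exists>w. t \<mapsto>\<^sup>* w \<and> nf \<Gamma> w SAtm)"
| "val (SAnd A B) \<Gamma> t \<longleftrightarrow>
    (\<exists>u v. t \<mapsto>\<^sup>* PPair u v \<and> stably (val A) \<Gamma> u \<and> stably (val B) \<Gamma> v) \<or>
    (\<exists>w. t \<mapsto>\<^sup>* w \<and> ne \<Gamma> w (SAnd A B))"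
| "val (SOr A B) \<Gamma> t \<longleftrightarrow>
    (\<exists>u. t \<mapsto>\<^sup>* Inj0 u \<and> stably (val A) \<Gamma> u) \<or> (\<exists>u. t \<mapsto>\<^sup>* Inj1 u \<and> stably (val B) \<Gamma> u)"
| "val (SImp A B) \<Gamma> t \<longleftrightarrow>
    (\<exists>b. t \<mapsto>\<^sup>* Lam b \<and> (\<forall>\<Gamma>' \<rho> u. ren_ok \<rho> \<Gamma> \<Gamma>' \<longrightarrow> stably (val A) \<Gamma>' u \<longrightarrow>
      val B \<Gamma>' (psub (case_nat u (\<lambda>i. Var (\<rho> i))) b))) \<or>
    (\<exists>w. t \<mapsto>\<^sup>* w \<and> ne \<Gamma> w (SImp A B))"
| "val (SAll A) \<Gamma> t \<longleftrightarrow> (\<forall>n. val A \<Gamma> (TApp t (num n)))"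
| "val (SEx A) \<Gamma> t \<longleftrightarrow> (\<exists>n u. t \<mapsto>\<^sup>* Pack (num n) u \<and> stably (val A) \<Gamma> u)"

lemma val_expand: "t \<mapsto>\<^sup>* t' \<Longrightarrow> val A \<Gamma> t' \<Longrightarrow> val A \<Gamma> t"
proof (induction A arbitrary: t t')
  case (SAll A)
  then show ?case by (auto intro: reds_TApp)
qed (simp; meson rtranclp_trans)+

lemma val_expand1: "t \<mapsto> t' \<Longrightarrow> val A \<Gamma> t' \<Longrightarrow> val A \<Gamma> t"
  by (blast intro: val_expand)

lemma stably_val: "stably (val A) \<Gamma> t \<Longrightarrow> val A \<Gamma> t"
  unfolding stably_def using ren_ok_id wk_id by metis

lemma stably_wk: "stably X \<Gamma> t \<Longrightarrow> ren_ok \<rho> \<Gamma> \<Gamma>' \<Longrightarrow> stably X \<Gamma>' (wk \<rho> \<eta> t)"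
  by (auto simp: stably_def wk_wk intro: ren_ok_comp)

section \<open>Reflection of neutral terms and reification\<close>

text \<open>Each negative shape has room for neutral terms in its own clause and
  \<open>ne_neg_shape\<close> excludes the other shapes, so a case analysis suffices.\<close>

lemma val_reflect: "ne \<Gamma> w A \<Longrightarrow> t \<mapsto>\<^sup>* w \<Longrightarrow> val A \<Gamma> t"
  using ne_neg_shape[of \<Gamma> w A] by (cases A) (auto intro: nf_ne)

lemma stably_val_ne: "ne \<Gamma> t A \<Longrightarrow> stably (val A) \<Gamma> t"
  by (auto simp: stably_def intro: val_reflect nf_wk)

lemma val_reify: "neg_shape A \<Longrightarrow> val A \<Gamma> t \<Longrightarrow> \<exists>w. t \<mapsto>\<^sup>* w \<and> nf \<Gamma> w A"
proof (induction A arbitrary: \<Gamma> t)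
  case (SAnd A B)
  from SAnd.prems(2) consider u v where "t \<mapsto>\<^sup>* PPair u v" "val A \<Gamma> u" "val B \<Gamma> v"
    | w where "t \<mapsto>\<^sup>* w" "ne \<Gamma> w (SAnd A B)"
    by (auto dest: stably_val)
  then show ?case
  proof cases
    case 1
    obtain u' v' where "u \<mapsto>\<^sup>* u'" "nf \<Gamma> u' A" "v \<mapsto>\<^sup>* v'" "nf \<Gamma> v' B"
      using SAnd.IH(1)[OF _ 1(2)] SAnd.IH(2)[OF _ 1(3)] SAnd.prems(1) by auto
    then have "t \<mapsto>\<^sup>* PPair u' v'" "nf \<Gamma> (PPair u' v') (SAnd A B)"
      by (auto intro: rtranclp_trans[OF 1(1) reds_PPair] nf_PPair)
    then show ?thesis by blast
  qed (auto intro: nf_ne)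
next
  case (SImp A B)
  from SImp.prems(2) consider b where "t \<mapsto>\<^sup>* Lam b"
      "\<And>\<Gamma>' \<rho> u. ren_ok \<rho> \<Gamma> \<Gamma>' \<Longrightarrow> stably (val A) \<Gamma>' u \<Longrightarrow> val B \<Gamma>' (psub (case_nat u (\<lambda>i. Var (\<rho> i))) b)"
    | w where "t \<mapsto>\<^sup>* w" "ne \<Gamma> w (SImp A B)"
    by auto
  then show ?case
  proof cases
    case 1
    \<comment> \<open>The body is evaluated at a fresh variable, which is neutral because
      \<open>A\<close> is negative. Instantiating with it after weakening is the identity, so it is
      the body itself that gets normalized.\<close>
    have "stably (val A) (A # \<Gamma>) (Var 0)"
      using SImp.prems ne_Var[of 0 "A # \<Gamma>"] by (auto intro: stably_val_ne)
    then have "val B (A # \<Gamma>) (psub (case_nat (Var 0) (\<lambda>i. Var (Suc i))) b)"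
      by (intro 1) auto
    moreover have "case_nat (Var 0) (\<lambda>i. Var (Suc i)) = Var"
      by (auto simp: fun_eq_iff split: nat.splits)
    ultimately have "val B (A # \<Gamma>) b"
      by (simp add: psub_eq_sub)
    then obtain b' where "b \<mapsto>\<^sup>* b'" "nf (A # \<Gamma>) b' B"
      using SImp.IH(2) SImp.prems(1) by fastforce
    then have "t \<mapsto>\<^sup>* Lam b'" "nf \<Gamma> (Lam b') (SImp A B)"
      by (auto intro: rtranclp_trans[OF 1(1) reds_Lam] nf_Lam)
    then show ?thesis by blast
  qed (auto intro: nf_ne)
qed auto

section \<open>Closure under eliminations and Post rules\<close>

lemma val_App:
  assumes "val (SImp A B) \<Gamma> t" "stably (val A) \<Gamma> u"
  shows "val B \<Gamma> (App t u)"
  using assms(1) unfolding val.simps(4)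
proof (elim disjE exE conjE)
  fix b
  assume b: "t \<mapsto>\<^sup>* Lam b" "\<forall>\<Gamma>' \<rho> u. ren_ok \<rho> \<Gamma> \<Gamma>' \<longrightarrow> stably (val A) \<Gamma>' u \<longrightarrow>
      val B \<Gamma>' (psub (case_nat u (\<lambda>i. Var (\<rho> i))) b)"
  have "App t u \<mapsto>\<^sup>* App (Lam b) u"
    using b(1) by (intro reds_App) auto
  also have "App (Lam b) u \<mapsto> psub (inst_p u) b"
    by (rule red.beta)
  finally have "App t u \<mapsto>\<^sup>* psub (inst_p u) b" .
  moreover have "val B \<Gamma> (psub (inst_p u) b)"
    using b(2)[rule_format, OF ren_ok_id assms(2)] by (simp add: inst_p_def)
  ultimately show ?thesis by (rule val_expand)
next
  fix w
  assume w: "t \<mapsto>\<^sup>* w" "ne \<Gamma> w (SImp A B)"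
  \<comment> \<open>For the application to be neutral its argument has to be normal; the negative
    shape of the neutral function allows the argument to be reified.\<close>
  have "neg_shape A" using ne_neg_shape[OF w(2)] by simp
  then obtain u' where "u \<mapsto>\<^sup>* u'" "nf \<Gamma> u' A"
    using val_reify[OF _ stably_val[OF assms(2)]] by blast
  with w show ?thesis by (intro val_reflect[OF ne_App reds_App])
qed

lemma val_Proj0:
  assumes "val (SAnd A B) \<Gamma> t"
  shows "val A \<Gamma> (Proj0 t)"
  using assms unfolding val.simps(2)
proof (elim disjE exE conjE)
  fix u v
  assume "t \<mapsto>\<^sup>* PPair u v" and v: "stably (val A) \<Gamma> u"
  then have "Proj0 t \<mapsto>\<^sup>* u"
    by (blast intro: rtranclp.rtrancl_into_rtrancl reds_Proj0 red.proj0)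
  then show ?thesis using stably_val[OF v] by (rule val_expand)
next
  fix w
  assume "t \<mapsto>\<^sup>* w" "ne \<Gamma> w (SAnd A B)"
  then show ?thesis by (intro val_reflect[OF ne_Proj0 reds_Proj0])
qed

lemma val_Proj1:
  assumes "val (SAnd A B) \<Gamma> t"
  shows "val B \<Gamma> (Proj1 t)"
  using assms unfolding val.simps(2)
proof (elim disjE exE conjE)
  fix u v
  assume "t \<mapsto>\<^sup>* PPair u v" and v: "stably (val B) \<Gamma> v"
  then have "Proj1 t \<mapsto>\<^sup>* v"
    by (blast intro: rtranclp.rtrancl_into_rtrancl reds_Proj1 red.proj1)
  then show ?thesis using stably_val[OF v] by (rule val_expand)
next
  fix w
  assume "t \<mapsto>\<^sup>* w" "ne \<Gamma> w (SAnd A B)"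
  then show ?thesis by (intro val_reflect[OF ne_Proj1 reds_Proj1])
qed

lemma val_Post:
  assumes "\<forall>u\<in>set us. val SAtm \<Gamma> u"
  shows "val SAtm \<Gamma> (Post us)"
proof -
  from assms have "\<forall>u\<in>set us. \<exists>w. u \<mapsto>\<^sup>* w \<and> nf \<Gamma> w SAtm" by simp
  then obtain f where f: "\<forall>u\<in>set us. u \<mapsto>\<^sup>* f u \<and> nf \<Gamma> (f u) SAtm" by metis
  then have "list_all2 reds us (map f us)"
    by (auto simp: list_all2_conv_all_nth)
  then have "Post us \<mapsto>\<^sup>* Post (map f us)"
    using reds_Post[of us _ "[]"] by simp
  moreover have "nf \<Gamma> (Post (map f us)) SAtm"
    using f by (auto intro!: nf_Post)
  ultimately show ?thesis by auto
qed

section \<open>Environments and membership of normal forms\<close>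

text \<open>\<open>N\<close> selects the positions that are constrained: all of them in
  \<open>fundamental\<close>, those of negative shape for normal forms, which contain no other free
  variables. A variable of another shape need not be related to itself.\<close>

definition env :: "(shape \<Rightarrow> bool) \<Rightarrow> shape list \<Rightarrow> shape list \<Rightarrow> (nat \<Rightarrow> pterm) \<Rightarrow> bool" where
  "env N \<Gamma> \<Gamma>' \<theta> \<longleftrightarrow> (\<forall>x<length \<Gamma>. N (\<Gamma> ! x) \<longrightarrow> stably (val (\<Gamma> ! x)) \<Gamma>' (\<theta> x))"

lemma env_wk: "env N \<Gamma> \<Gamma>' \<theta> \<Longrightarrow> ren_ok \<rho> \<Gamma>' \<Gamma>'' \<Longrightarrow> env N \<Gamma> \<Gamma>'' (\<lambda>i. wk \<rho> \<eta> (\<theta> i))"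
  unfolding env_def by (blast intro: stably_wk)

lemma env_Cons: "env N \<Gamma> \<Gamma>' \<theta> \<Longrightarrow> stably (val A) \<Gamma>' u \<Longrightarrow> env N (A # \<Gamma>) \<Gamma>' (case_nat u \<theta>)"
  by (auto simp: env_def nth_Cons split: nat.splits)

lemma env_up_h: "env N \<Gamma> \<Gamma>' \<theta> \<Longrightarrow> env N \<Gamma> \<Gamma>' (up_h \<theta>)"
  using env_wk[of N \<Gamma> \<Gamma>' \<theta> "\<lambda>x. x" \<Gamma>' Suc] by (simp add: up_h_def hren_eq_sub wk_def)

text \<open>The argument may live in a larger context, so the environment is weakened before it is
  extended; \<open>sub_up_p\<close> merges both substitutions into one.\<close>

lemma val_Lam:
  assumes "env N \<Gamma> \<Gamma>' \<theta>"
    and "\<And>\<Gamma>' \<theta>. env N (A # \<Gamma>) \<Gamma>' \<theta> \<Longrightarrow> val B \<Gamma>' (sub \<sigma> \<delta> \<theta> t)"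
  shows "val (SImp A B) \<Gamma>' (Lam (sub \<sigma> \<delta> (up_p \<theta>) t))"
proof -
  have "val B \<Gamma>'' (psub (case_nat u (\<lambda>i. Var (\<rho> i))) (sub \<sigma> \<delta> (up_p \<theta>) t))"
    if "ren_ok \<rho> \<Gamma>' \<Gamma>''" "stably (val A) \<Gamma>'' u" for \<Gamma>'' \<rho> u
    using assms(2)[OF env_Cons[OF env_wk[OF assms(1) that(1), of "\<lambda>a. a"] that(2)]]
    by (simp add: psub_eq_sub sub_up_p wk_def)
  then show ?thesis by auto
qed

lemma nf_val:
  "ne \<Gamma> t A \<Longrightarrow> env neg_shape \<Gamma> \<Gamma>' \<theta> \<Longrightarrow> val A \<Gamma>' (sub TVar (ren_d \<eta>) \<theta> t)"
  "nf \<Gamma> t A \<Longrightarrow> env neg_shape \<Gamma> \<Gamma>' \<theta> \<Longrightarrow> val A \<Gamma>' (sub TVar (ren_d \<eta>) \<theta> t)"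
proof (induction arbitrary: \<Gamma>' \<theta> \<eta> and \<Gamma>' \<theta> \<eta> rule: ne_nf.inducts)
  have st: "stably (val A) \<Gamma>' (sub TVar (ren_d \<eta>) \<theta> t)"
    if "\<And>\<Gamma>' \<theta> \<eta>. env neg_shape \<Gamma> \<Gamma>' \<theta> \<Longrightarrow> val A \<Gamma>' (sub TVar (ren_d \<eta>) \<theta> t)" "env neg_shape \<Gamma> \<Gamma>' \<theta>" for \<Gamma> A \<Gamma>' \<eta> \<theta> t
    using that by (auto simp: stably_def wk_sub comp_d_ren_d env_wk)
  {
    case (ne_Var x \<Gamma>)
    then show ?case by (auto simp: env_def intro: stably_val)
  next
    case (ne_App \<Gamma> t A B u)
    from val_App[OF ne_App.IH(1)[OF ne_App.prems] st[OF ne_App.IH(2) ne_App.prems]]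
    show ?case by simp
  next
    case (ne_Proj0 \<Gamma> t A B)
    from val_Proj0[OF ne_Proj0.IH[OF ne_Proj0.prems]] show ?case by simp
  next
    case (ne_Proj1 \<Gamma> t A B)
    from val_Proj1[OF ne_Proj1.IH[OF ne_Proj1.prems]] show ?case by simp
  next
    case (ne_Hyp n P \<Gamma> a)
    then show ?case using ne_nf.ne_Hyp[of n P \<Gamma>' "\<eta> a"] by (auto intro: nf_ne)
  next
    case (nf_Lam A \<Gamma> t B)
    then show ?case using val_Lam by simp
  next
    case (nf_PPair \<Gamma> t A u B)
    from st[OF nf_PPair.IH(1) nf_PPair.prems] st[OF nf_PPair.IH(2) nf_PPair.prems]
    show ?case by auto
  next
    case (nf_TrueP \<Gamma>)
    then show ?case by (auto intro: ne_nf.nf_TrueP)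
  next
    case (nf_Post us \<Gamma>)
    then show ?case by (simp add: val_Post del: val.simps)
  }
qed auto

text \<open>Having a normal form in the relation is not immediate from being its expansion, since
  closure runs from reduct to redex. Normal forms are therefore evaluated anew by
  \<open>nf_val\<close>, with every admissible variable standing for itself up to weakening.\<close>

lemma stably_nf:
  assumes "nf \<Gamma> t A"
  shows "stably (val A) \<Gamma> t"
proof -
  have "env neg_shape \<Gamma> \<Gamma>' (\<lambda>i. Var (\<rho> i))" if "ren_ok \<rho> \<Gamma> \<Gamma>'" for \<Gamma>' \<rho>
    using that ne_Var unfolding env_def ren_ok_def by (metis stably_val_ne)
  then show ?thesis
    using nf_val(2)[OF assms(1)] by (auto simp: stably_def wk_def)
qed


section \<open>The fundamental lemma\<close>

lemma tsub_numerals: "\<forall>i. \<exists>k. \<sigma> i = num k \<Longrightarrow> \<exists>k. tsub \<sigma> t = num k"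
proof (induction t)
  case (Succ t)
  then obtain k where "tsub \<sigma> t = num k" by auto
  then show ?case by (intro exI[of _ "Suc k"]) simp
qed (auto intro: exI[of _ 0])

text \<open>A numeral instance has no free variables, so its truth value is the same in all
  environments.\<close>

lemma closed_true_or_false:
  assumes "\<forall>i. \<exists>k. \<sigma> i = num k"
  shows "closed_true (asub \<sigma> P) \<or> closed_false (asub \<sigma> P)"
proof -
  have "tfv (tsub \<sigma> t) = {}" for t
    using tsub_numerals[OF assms, of t] by auto
  then have "afv (asub \<sigma> P) = {}"
    unfolding afv_def by transfer auto
  moreover have "tval e (num k) = k" for e k
    by (induction k) auto
  then have "tval e (\<sigma> i) = tval e' (\<sigma> i)" for e e' i
    using assms by metis
  then have "(\<lambda>i. tval e (\<sigma> i)) = (\<lambda>i. tval e' (\<sigma> i))" for e e'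
    by blast
  then have "holds e (asub \<sigma> P) = holds e' (asub \<sigma> P)" for e e'
    unfolding holds_asub by metis
  ultimately show ?thesis
    by (auto simp: closed_true_def closed_false_def)
qed

lemma val_Hyp:
  assumes "\<forall>i. \<exists>k. \<sigma> i = num k"
  shows "val (SAll SAtm) \<Gamma> (Hyp a (asub (up \<sigma>) P))"
proof -
  have "val SAtm \<Gamma> (TApp (Hyp a (asub (up \<sigma>) P)) (num n))" for n
  proof -
    have "\<forall>i. \<exists>k. case_nat (num n) \<sigma> i = num k"
      using assms by (auto split: nat.splits)
    then consider "closed_true (asub (inst (num n)) (asub (up \<sigma>) P))"
      | "closed_false (asub (inst (num n)) (asub (up \<sigma>) P))"
      unfolding asub_asub inst_up using closed_true_or_false by blast
    then show ?thesis
    proof cases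
      case 1
      then show ?thesis by (rule val_expand1[OF red.hyp]) (auto intro: nf_TrueP)
    next
      case 2
      then show ?thesis by (auto intro: nf_ne ne_Hyp)
    qed
  qed
  then show ?thesis by simp
qed

text \<open>Evaluating the left branch yields a normal witness. Either the hypothesis has disappeared from
  it, or it contains a refutation of the hypothesis, which is handed to the right branch.\<close>

lemma val_Par:
  assumes "neg_shape Q" "val (SEx Q) \<Gamma> u"
    and v: "\<And>n. val (SEx Q) \<Gamma> (winst 0 n v)"
  shows "val (SEx Q) \<Gamma> (Par u v)"
proof -
  obtain m w where "u \<mapsto>\<^sup>* Pack (num m) w" "val Q \<Gamma> w"
    using assms(2) by (auto dest: stably_val)
  moreover then obtain w' where w': "w \<mapsto>\<^sup>* w'" "nf \<Gamma> w' Q"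
    using val_reify[OF assms(1)] by blast
  moreover have "Pack (num m) w \<mapsto>\<^sup>* Pack (num m) w'"
    using w'(1) by (rule reds_Pack)
  ultimately have "u \<mapsto>\<^sup>* Pack (num m) w'" by simp
  then have reds: "Par u v \<mapsto>\<^sup>* Par (Pack (num m) w') v"
    by (rule reds_Par)
  show ?thesis
  proof (cases "hfree 0 w'")
    case True
    then obtain n where "raises 0 n w'"
      using nf_hfree_raises(2)[OF w'(2)] by blast
    then have "Par (Pack (num m) w') v \<mapsto> winst 0 n v"
      by (intro red.par1) simp
    with reds v show ?thesis by (blast intro: val_expand val_expand1)
  next
    case False
    then have "Par (Pack (num m) w') v \<mapsto> hren (\<lambda>i. i - 1) (Pack (num m) w')"
      by (intro red.par0) simp
    then have "Par (Pack (num m) w') v \<mapsto> Pack (num m) (wk (\<lambda>x. x) (\<lambda>i. i - 1) w')"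
      by (simp add: hren_eq_sub wk_def)
    moreover have "stably (val Q) \<Gamma> (wk (\<lambda>x. x) (\<lambda>i. i - 1) w')"
      using w'(2) by (intro stably_nf nf_wk(2)) auto
    ultimately show ?thesis using reds by (auto intro: rtranclp.rtrancl_into_rtrancl)
  qed
qed

section \<open>Closing substitutions and evaluation of typed terms\<close>

text \<open>A free \<open>Wit\<close> is irreducible and \<open>SEx\<close> has no neutral
  alternative, so every existential hypothesis must have a number. Universal hypotheses may remain
  variables.\<close>

definition wit_ok :: "fm list \<Rightarrow> (nat \<Rightarrow> nat \<times> nat option) \<Rightarrow> bool" where
  "wit_ok \<Delta> \<delta> \<longleftrightarrow> (\<forall>a<length \<Delta>. \<forall>A. \<Delta> ! a = Ex A \<longrightarrow> snd (\<delta> a) \<noteq> None)"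

lemma wit_ok_ren: "wit_ok \<Delta> \<delta> \<Longrightarrow> wit_ok \<Delta> (comp_d (ren_d \<eta>) \<delta>)"
  by (fastforce simp: wit_ok_def)

lemma wit_ok_shift: "wit_ok \<Delta> \<delta> \<Longrightarrow> wit_ok (map (fsub shift) \<Delta>) \<delta>"
proof -
  have "\<exists>B. A = Ex B" if "fsub shift A = Ex A'" for A A'
    using that by (cases A) auto
  then show "wit_ok \<Delta> \<delta> \<Longrightarrow> wit_ok (map (fsub shift) \<Delta>) \<delta>"
    unfolding wit_ok_def by fastforce
qed

lemma wit_ok_up_d: "wit_ok \<Delta> \<delta> \<Longrightarrow> wit_ok (All A # \<Delta>) (up_d \<delta>)"
  by (auto simp: wit_ok_def up_d_def nth_Cons split: nat.splits)

lemma wit_ok_Cons: "wit_ok \<Delta> \<delta> \<Longrightarrow> wit_ok (A # \<Delta>) (case_nat (i, Some n) \<delta>)"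
  by (auto simp: wit_ok_def nth_Cons split: nat.splits)

abbreviation good ::
  "fm list \<Rightarrow> fm list \<Rightarrow> shape list \<Rightarrow> (nat \<Rightarrow> tm) \<Rightarrow> (nat \<Rightarrow> nat \<times> nat option) \<Rightarrow> (nat \<Rightarrow> pterm) \<Rightarrow> bool"
  where
  "good \<Gamma> \<Delta> \<Gamma>' \<sigma> \<delta> \<theta> \<equiv> (\<forall>i. \<exists>k. \<sigma> i = num k) \<and>
    env (\<lambda>_. True) (map shape_of \<Gamma>) \<Gamma>' \<theta> \<and> wit_ok \<Delta> \<delta>"

text \<open>The recursive call is an argument of the step function and must be stably in the
  relation. Hence the induction on the numeral ranges over all good environments.\<close>

lemma val_Rec:
  assumes u: "\<And>\<Gamma>' \<delta> \<theta>. good \<Gamma> \<Delta> \<Gamma>' \<sigma> \<delta> \<theta> \<Longrightarrow> val A \<Gamma>' (sub \<sigma> \<delta> \<theta> u)"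
    and v: "\<And>\<Gamma>' \<delta> \<theta>. good \<Gamma> \<Delta> \<Gamma>' \<sigma> \<delta> \<theta> \<Longrightarrow> val (SAll (SImp A A)) \<Gamma>' (sub \<sigma> \<delta> \<theta> v)"
  shows "good \<Gamma> \<Delta> \<Gamma>' \<sigma> \<delta> \<theta> \<Longrightarrow> val A \<Gamma>' (Rec (sub \<sigma> \<delta> \<theta> u) (sub \<sigma> \<delta> \<theta> v) (num n))"
proof (induction n arbitrary: \<Gamma>' \<delta> \<theta>)
  case 0
  then show ?case using u by (auto intro: val_expand1[OF red.rec0])
next
  case (Suc n)
  have "stably (val A) \<Gamma>' (Rec (sub \<sigma> \<delta> \<theta> u) (sub \<sigma> \<delta> \<theta> v) (num n))"
    unfolding stably_def
  proof (intro allI impI)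
    fix \<Gamma>'' \<rho> \<eta>
    assume "ren_ok \<rho> \<Gamma>' \<Gamma>''"
    then have "good \<Gamma> \<Delta> \<Gamma>'' \<sigma> (comp_d (ren_d \<eta>) \<delta>) (\<lambda>i. wk \<rho> \<eta> (\<theta> i))"
      using Suc.prems by (auto intro: env_wk wit_ok_ren)
    from Suc.IH[OF this]
    show "val A \<Gamma>'' (wk \<rho> \<eta> (Rec (sub \<sigma> \<delta> \<theta> u) (sub \<sigma> \<delta> \<theta> v) (num n)))"
      by (simp add: wk_sub[symmetric]) (simp add: wk_def)
  qed
  moreover have "val (SImp A A) \<Gamma>' (TApp (sub \<sigma> \<delta> \<theta> v) (num n))"
    using v[OF Suc.prems] by (simp del: val.simps add: val.simps(5))
  ultimately have "val A \<Gamma>' (App (TApp (sub \<sigma> \<delta> \<theta> v) (num n)) (Rec (sub \<sigma> \<delta> \<theta> u) (sub \<sigma> \<delta> \<theta> v) (num n)))"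
    by (rule val_App[rotated])
  then show ?case by (simp add: val_expand1[OF red.recS])
qed

theorem fundamental:
  "typed R \<Gamma> \<Delta> t A \<Longrightarrow> good \<Gamma> \<Delta> \<Gamma>' \<sigma> \<delta> \<theta> \<Longrightarrow> val (shape_of A) \<Gamma>' (sub \<sigma> \<delta> \<theta> t)"
proof (induction arbitrary: \<Gamma>' \<sigma> \<delta> \<theta> rule: typed.induct)
  \<comment> \<open>A weakened instance of \<open>t\<close> is its instance under the weakened
    environment, which is again good. So membership for all good environments already gives
    \<open>stably\<close>.\<close>
  have st: "stably (val A) \<Gamma>' (sub \<sigma> \<delta> \<theta> t)"
    if "\<And>\<Gamma>' \<sigma> \<delta> \<theta>. good \<Gamma> \<Delta> \<Gamma>' \<sigma> \<delta> \<theta> \<Longrightarrow> val A \<Gamma>' (sub \<sigma> \<delta> \<theta> t)" "good \<Gamma> \<Delta> \<Gamma>' \<sigma> \<delta> \<theta>"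
    for \<Gamma> \<Delta> A \<Gamma>' \<sigma> \<delta> \<theta> t
    using that by (auto simp: stably_def wk_sub env_wk wit_ok_ren)
  have num: "\<forall>i. \<exists>k. case_nat (num n) \<sigma> i = num k" if "\<forall>i. \<exists>k. \<sigma> i = num k" for n \<sigma>
    using that by (auto split: nat.splits)
  have [simp]: "shape_of \<circ> fsub \<sigma> = shape_of" for \<sigma>
    by auto
  {
    case (Ax x \<Gamma> \<Delta>)
    then show ?case by (auto simp: env_def dest: stably_val)
  next
    case (H a \<Delta> P \<Gamma>)
    then show ?case using val_Hyp by (simp del: val.simps)
  next
    case (W a \<Delta> P \<Gamma>)
    \<comment> \<open>By \<open>wit_ok\<close> the substitution has replaced this \<open>Wit\<close>
      by \<open>Pack (num n) TrueP\<close>.\<close>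
    then obtain n where "snd (\<delta> a) = Some n" by (auto simp: wit_ok_def)
    then show ?case using stably_nf[OF nf_TrueP] by auto
  next
    case (AndI \<Gamma> \<Delta> u A v B)
    from st[OF AndI.IH(1) AndI.prems] st[OF AndI.IH(2) AndI.prems] show ?case by auto
  next
    case (AndE0 \<Gamma> \<Delta> u A B)
    from val_Proj0[OF AndE0.IH[OF AndE0.prems, unfolded shape_of.simps]] show ?case by simp
  next
    case (AndE1 \<Gamma> \<Delta> u A B)
    from val_Proj1[OF AndE1.IH[OF AndE1.prems, unfolded shape_of.simps]] show ?case by simp
  next
    case (ImpI A \<Gamma> \<Delta> u B)
    then show ?case by (auto intro!: val_Lam simp del: val.simps)
  next
    case (ImpE \<Gamma> \<Delta> t A B u)
    have "val (SImp (shape_of A) (shape_of B)) \<Gamma>' (sub \<sigma> \<delta> \<theta> t)"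
      using ImpE.IH(1)[OF ImpE.prems] by (simp del: val.simps)
    then show ?case using st[OF ImpE.IH(2) ImpE.prems] by (simp add: val_App)
  next
    case (OrI0 \<Gamma> \<Delta> u A B)
    from st[OF OrI0.IH OrI0.prems] show ?case by auto
  next
    case (OrI1 \<Gamma> \<Delta> u B A)
    from st[OF OrI1.IH OrI1.prems] show ?case by auto
  next
    case (OrE \<Gamma> \<Delta> u A B v C w)
    let ?C = "Case (sub \<sigma> \<delta> \<theta> u) (sub \<sigma> \<delta> (up_p \<theta>) v) (sub \<sigma> \<delta> (up_p \<theta>) w)"
    have "val (SOr (shape_of A) (shape_of B)) \<Gamma>' (sub \<sigma> \<delta> \<theta> u)"
      using OrE.IH(1)[OF OrE.prems] by simp
    then have "val (shape_of C) \<Gamma>' ?C"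
      unfolding val.simps(3)
    proof (elim disjE exE conjE)
      fix u'
      assume u: "sub \<sigma> \<delta> \<theta> u \<mapsto>\<^sup>* Inj0 u'" "stably (val (shape_of A)) \<Gamma>' u'"
      have "?C \<mapsto>\<^sup>* sub \<sigma> \<delta> (case_nat u' \<theta>) v"
        using reds_Case[OF u(1)] red.case0 unfolding psub_inst_p[symmetric]
        by (rule rtranclp.rtrancl_into_rtrancl)
      moreover have "val (shape_of C) \<Gamma>' (sub \<sigma> \<delta> (case_nat u' \<theta>) v)"
        using OrE.prems u(2) by (intro OrE.IH(2)) (auto intro: env_Cons)
      ultimately show ?thesis by (rule val_expand)
    next
      fix u'
      assume u: "sub \<sigma> \<delta> \<theta> u \<mapsto>\<^sup>* Inj1 u'" "stably (val (shape_of B)) \<Gamma>' u'"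
      have "?C \<mapsto>\<^sup>* sub \<sigma> \<delta> (case_nat u' \<theta>) w"
        using reds_Case[OF u(1)] red.case1 unfolding psub_inst_p[symmetric]
        by (rule rtranclp.rtrancl_into_rtrancl)
      moreover have "val (shape_of C) \<Gamma>' (sub \<sigma> \<delta> (case_nat u' \<theta>) w)"
        using OrE.prems u(2) by (intro OrE.IH(3)) (auto intro: env_Cons)
      ultimately show ?thesis by (rule val_expand)
    qed
    then show ?case by simp
  next
    case (AllI \<Gamma> \<Delta> u A)
    have "val (shape_of A) \<Gamma>' (TApp (TLam (sub (up \<sigma>) \<delta> (up_n \<theta>) u)) (num n))" for n
    proof (rule val_expand1[OF red.tbeta])
      show "val (shape_of A) \<Gamma>' (nsub (inst (num n)) (sub (up \<sigma>) \<delta> (up_n \<theta>) u))"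
        unfolding nsub_inst using AllI.prems by (intro AllI.IH) (auto intro: num[rule_format] wit_ok_shift)
    qed
    then show ?case by simp
  next
    case (AllE \<Gamma> \<Delta> u A m)
    obtain k where "tsub \<sigma> m = num k"
      using tsub_numerals AllE.prems by blast
    then show ?case using AllE.IH[OF AllE.prems] by simp
  next
    case (ExI \<Gamma> \<Delta> u m A)
    obtain k where k: "tsub \<sigma> m = num k"
      using tsub_numerals ExI.prems by blast
    from st[OF ExI.IH ExI.prems] show ?case by (auto simp: k)
  next
    case (ExE \<Gamma> \<Delta> u A t C)
    obtain n u' where u: "sub \<sigma> \<delta> \<theta> u \<mapsto>\<^sup>* Pack (num n) u'" "stably (val (shape_of A)) \<Gamma>' u'"
      using ExE.IH(1)[OF ExE.prems] by auto
    have "Unpack (sub \<sigma> \<delta> \<theta> u) (sub (up \<sigma>) \<delta> (up_p (up_n \<theta>)) t) \<mapsto>\<^sup>*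
        sub (case_nat (num n) \<sigma>) \<delta> (case_nat u' \<theta>) t"
      using reds_Unpack[OF u(1)] red.unpack unfolding psub_nsub_inst[symmetric]
      by (rule rtranclp.rtrancl_into_rtrancl)
    moreover have "val (shape_of (fsub shift C)) \<Gamma>' (sub (case_nat (num n) \<sigma>) \<delta> (case_nat u' \<theta>) t)"
      using ExE.prems u(2) by (intro ExE.IH(2)) (auto intro: num[rule_format] wit_ok_shift env_Cons)
    ultimately show ?case by (auto intro: val_expand)
  next
    case (Ind \<Gamma> \<Delta> u A v m)
    obtain k where "tsub \<sigma> m = num k"
      using tsub_numerals Ind.prems by blast
    moreover have "val (shape_of A) \<Gamma>' (Rec (sub \<sigma> \<delta> \<theta> u) (sub \<sigma> \<delta> \<theta> v) (num k))"
      using Ind.IH by (intro val_Rec[OF _ _ Ind.prems]) (simp_all del: val.simps)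
    ultimately show ?case by simp
  next
    case (PostI us As A \<Gamma> \<Delta>)
    then have "\<forall>u\<in>set us. val SAtm \<Gamma>' (sub \<sigma> \<delta> \<theta> u)"
      by (fastforce simp: list_all2_conv_all_nth in_set_conv_nth simp del: val.simps)
    then show ?case by (simp add: val_Post del: val.simps)
  next
    case (PostI0 A \<Gamma> \<Delta>)
    then show ?case by (auto intro: nf_TrueP)
  next
    case (EM \<Gamma> P \<Delta> u Q v)
    have "val (shape_of (Ex Q)) \<Gamma>' (sub \<sigma> (up_d \<delta>) (up_h \<theta>) u)"
      using EM.prems by (intro EM.IH(1)) (auto intro: env_up_h wit_ok_up_d)
    \<comment> \<open>The left branch kept its hypothesis free through \<open>up_d\<close>. Here the
      bound variable is given the witness \<open>n\<close> instead, and the index 0 paired with it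
      is a filler.\<close>
    moreover have "val (shape_of (Ex Q)) \<Gamma>' (winst 0 n (sub \<sigma> (up_d \<delta>) (up_h \<theta>) v))" for n
      unfolding winst_sub_up_d
      using EM.prems by (intro EM.IH(2)) (auto intro: wit_ok_Cons)
    ultimately show ?case using EM.hyps by (simp add: val_Par del: val.simps)
  }
qed

section \<open>Evaluation of closed proofs\<close>

lemma closed_val:
  assumes "typed R [] [] t A" "nfv t = {}"
  shows "val (shape_of A) [] t"
proof -
  have "\<exists>k. Zero = num k"
    by (rule exI[of _ 0]) simp
  \<comment> \<open>Sending every number variable to \<open>Zero\<close> meets the demand for
    numerals and leaves \<open>t\<close> unchanged, since \<open>t\<close> has no free number
    variable.\<close>
  then have "val (shape_of A) [] (nsub (\<lambda>_. Zero) t)"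
    unfolding nsub_eq_sub by (intro fundamental[OF assms(1)]) (auto simp: env_def wit_ok_def)
  then show ?thesis
    using assms(2) by (simp add: nsub_cong)
qed

theorem theorem4p7:
  fixes R :: "atom list \<Rightarrow> atom \<Rightarrow> bool"
  assumes "arith_post_rules R"
  shows "(\<forall>t A. nfv t = {} \<longrightarrow> typed R [] [] t (Ex A) \<longrightarrow>
      (\<exists>n u. t \<mapsto>\<^sup>* Pack (num n) u \<and> typed R [] [] u (fsub (inst (num n)) A))) \<and>
    (\<forall>t A B. nfv t = {} \<longrightarrow> typed R [] [] t (Or A B) \<longrightarrow>
      (\<exists>t'. t \<mapsto>\<^sup>* t' \<and>
        ((\<exists>u. t' = Inj0 u \<and> typed R [] [] u A) \<or> (\<exists>u. t' = Inj1 u \<and> typed R [] [] u B))))"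
proof (intro conjI allI impI)
  interpret arith_post_rules R by fact
  fix t
  assume nfv: "nfv t = {}"
  {
    fix A
    assume t: "typed R [] [] t (Ex A)"
    then obtain n u where u: "t \<mapsto>\<^sup>* Pack (num n) u"
      using closed_val[OF t nfv] by auto
    then have "typed R [] [] (Pack (num n) u) (Ex A)"
      using t by (rule subject_reduction_reds)
    then have "typed R [] [] u (fsub (inst (num n)) A)"
      by (auto elim: typed_PackE)
    with u show "\<exists>n u. t \<mapsto>\<^sup>* Pack (num n) u \<and> typed R [] [] u (fsub (inst (num n)) A)"
      by blast
  }
  fix A B
  assume t: "typed R [] [] t (Or A B)"
  then consider u where "t \<mapsto>\<^sup>* Inj0 u" | u where "t \<mapsto>\<^sup>* Inj1 u"
    using closed_val[OF t nfv] by auto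
  then show "\<exists>t'. t \<mapsto>\<^sup>* t' \<and>
      ((\<exists>u. t' = Inj0 u \<and> typed R [] [] u A) \<or> (\<exists>u. t' = Inj1 u \<and> typed R [] [] u B))"
  proof cases
    case 1
    then have "typed R [] [] (Inj0 u) (Or A B)"
      using t by (rule subject_reduction_reds)
    with 1 show ?thesis by (blast elim: typed_Inj0E)
  next
    case 2
    then have "typed R [] [] (Inj1 u) (Or A B)"
      using t by (rule subject_reduction_reds)
    with 2 show ?thesis by (blast elim: typed_Inj1E)
  qed
qed

end
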